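(* Assume the $abc$ Conjecture. For real $X$, let $$S(X):=\#\{\ell\le X:\ \ell \text{ is prime and } |\tau(n)|=\ell \text{ for some integer } n\ge 1\},$$ where $\tau$ is Ramanujan's tau-function. Then, as $X\to+\infty$, $$S(X)=O\bigl(X^{13/22}\bigr).$$
   Context: Ramanujan's tau-function $\tau:\mathbb Z_{\ge 1}\to\mathbb Z$ is defined by the identity $q\prod_{n\ge 1}(1-q^n)^{24}=\sum_{n\ge 1}\tau(n)q^n$. The $abc$ Conjecture is the statement: for every $\varepsilon>0$ there exists a constant $C_\varepsilon>0$ such that for all coprime nonzero integers $a,b,c$ with $a+b=c$ one has $|c|\le C_\varepsilon\,\operatorname{rad}(abc)^{1+\varepsilon}$, where $\operatorname{rad}(abc):=\prod_{p\mid abc}p$ is the product of the distinct primes dividing $abc$. *)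

theory Defs
  imports "HOL-Analysis.Analysis" "HOL-Library.Landau_Symbols"
begin

text \<open>The factors of the product below are formal power series and \<open>\<Prod>k\<close> is the limit of the
  partial products in their usual (X-adic) topology. Since the product binder starts at
  \<open>k = 0\<close>, its exponents are shifted by one.\<close>

definition ramanujan_tau :: "nat \<Rightarrow> int" where
  "ramanujan_tau n = fps_nth (fps_X * (\<Prod>k. (1 - fps_X ^ Suc k) ^ 24)) n"

text \<open>\<open>prodinf\<close> is a definite description, so we record that the product does converge.\<close>

lemma ramanujan_tau_product_converges:
  "(\<lambda>n. (1 - fps_X ^ Suc n) ^ 24 :: int fps) has_prod (\<Prod>n. (1 - fps_X ^ Suc n) ^ 24)"
proof -
  define P :: "nat \<Rightarrow> int fps" where "P = (\<lambda>n. \<Prod>i\<le>n. (1 - fps_X ^ Suc i) ^ 24)"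
  have nth_Suc: "fps_nth (P (Suc n)) k = fps_nth (P n) k" if "k \<le> n" for n k
  proof -
    have "x dvd 1 - (1 - x) ^ 24" for x :: "int fps"
      by algebra
    then obtain h where "1 - (1 - fps_X ^ Suc (Suc n) :: int fps) ^ 24 = fps_X ^ Suc (Suc n) * h"
      by (rule dvdE)
    then have factor: "(1 - fps_X ^ Suc (Suc n) :: int fps) ^ 24 = 1 - fps_X ^ Suc (Suc n) * h"
      by (metis diff_diff_eq2 add_diff_cancel_left')
    have "P (Suc n) = P n * (1 - fps_X ^ Suc (Suc n)) ^ 24"
      by (simp only: P_def prod.atMost_Suc)
    then have "P (Suc n) = P n - fps_X ^ Suc (Suc n) * (P n * h)"
      by (simp only: factor right_diff_distrib mult_1_right mult.left_commute)
    moreover have "fps_nth (fps_X ^ Suc (Suc n) * (P n * h)) k = 0"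
      using that by (simp add: fps_X_power_mult_nth del: power_Suc)
    ultimately show ?thesis
      by (simp del: power_Suc)
  qed
  have stable: "fps_nth (P n) k = fps_nth (P k) k" if "k \<le> n" for n k
    using that
  proof (induction n rule: dec_induct)
    case (step m)
    then show ?case using nth_Suc by simp
  qed simp
  define L where "L = Abs_fps (\<lambda>k. fps_nth (P k) k)"
  have "P \<longlonglongrightarrow> L"
    by (rule tendsto_fpsI) (auto simp: L_def eventually_at_top_linorder intro: stable)
  moreover have "L \<noteq> 0"
  proof
    assume "L = 0"
    then have "fps_nth L 0 = 0" by simp
    then show False by (simp add: L_def P_def fps_nth_power_0)
  qed
  ultimately have "(\<lambda>n. (1 - fps_X ^ Suc n) ^ 24 :: int fps) has_prod L"
    by (simp add: has_prod_def raw_has_prod_def P_def)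
  then show ?thesis
    using has_prod_unique by metis
qed

definition rad :: "int \<Rightarrow> int" where
  "rad m = \<Prod>(prime_factors m)"

definition abc_conjecture :: bool where
  "abc_conjecture \<longleftrightarrow>
    (\<forall>\<epsilon>::real. \<epsilon> > 0 \<longrightarrow>
      (\<exists>C::real. C > 0 \<and>
        (\<forall>a b c :: int. a \<noteq> 0 \<longrightarrow> b \<noteq> 0 \<longrightarrow> c \<noteq> 0 \<longrightarrow> Gcd {a, b, c} = 1 \<longrightarrow> a + b = c \<longrightarrow>
          of_int \<bar>c\<bar> \<le> C * of_int (rad (a * b * c)) powr (1 + \<epsilon>))))"

definition tau_prime_count :: "real \<Rightarrow> nat" where
  "tau_prime_count X =
    card {l :: nat. real l \<le> X \<and> prime l \<and> (\<exists>n\<ge>1. \<bar>ramanujan_tau n\<bar> = int l)}"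

end

theory Submission
  imports
    Defs
    "HOL-Complex_Analysis.Complex_Analysis"
    "HOL-Library.Z2"
    "HOL-Number_Theory.Cong"
    "HOL-Real_Asymp.Real_Asymp"
begin

text \<open>The prime 2 contributes at most one to the count, so let \<open>l = \<bar>\<tau>(n)\<bar>\<close> be an odd prime.
As \<open>\<tau>\<close> is multiplicative, \<open>l = \<bar>\<tau>(p ^ k)\<bar>\<close> for some prime power.
The Hecke recursion makes \<open>\<tau>(p ^ k)\<close> a Lucas number: put \<open>\<tau>(p) = 2 s\<close>, \<open>P = p ^ 11\<close>, \<open>N = k + 1\<close>
and let \<open>\<alpha>, \<beta>\<close> be the roots of \<open>x\<^sup>2 - 2 s x + P\<close>; then \<open>\<tau>(p ^ k) = U\<close> with
\<open>U = (\<alpha> ^ N - \<beta> ^ N) / (\<alpha> - \<beta>)\<close>. Since \<open>\<tau>(p)\<close> is even, \<open>U\<close> would be even for even \<open>N\<close>; so \<open>N \<ge> 3\<close>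
is odd. Moreover \<open>p\<close> does not divide \<open>2 s\<close>, for otherwise \<open>U\<close> would be even or divisible by \<open>p\<^sup>2\<close>.
With \<open>W = (\<alpha> ^ N + \<beta> ^ N) / 2\<close> one has the norm identity (\<open>lucas_norm\<close>)

  \<open>W\<^sup>2 + (P - s\<^sup>2) U\<^sup>2 = P ^ N\<close>.

If \<open>s\<^sup>2 \<ge> P\<close>, the roots are real and of the same sign and \<open>\<bar>U\<bar> \<ge> p ^ N\<close> holds directly. If \<open>s\<^sup>2 < P\<close>,
the three terms are positive and coprime, the right-hand side is \<open>p ^ (11 N)\<close>, and the radical of
their product is at most \<open>\<bar>W\<bar> (P - s\<^sup>2) l p \<le> p ^ (11 N / 2 + 12) l \<le> p ^ (19 N / 2) l\<close>. So the
\<open>abc\<close> conjecture with \<open>\<epsilon> = 1/19\<close> yields \<open>p ^ N \<le> C l ^ (20/19)\<close> (\<open>abc_imp_prime_power_bound\<close>). Hence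
every odd prime counted up to \<open>X\<close> comes from a pair \<open>(p, N)\<close> with \<open>N \<ge> 3\<close> and
\<open>p ^ N \<le> C X ^ (20/19)\<close>. There are only \<open>O(X ^ (20/57) log X)\<close> such pairs, and \<open>20/57 < 13/22\<close>.

Two facts about \<open>\<tau>\<close> enter. The first is the Hecke relation (\<open>ramanujan_tau_hecke\<close>)
\<open>\<tau>(p) \<tau>(n) = \<tau>(p n) + p ^ 11 \<tau>(n / p)\<close>. It expresses that the generating function
\<open>\<Delta>(z) = q \<Prod>(1 - q ^ n) ^ 24\<close>, \<open>q = exp(2 \<pi> i z)\<close>, is an eigenfunction of the Hecke operator. The
transformation law \<open>\<Delta>(- 1 / z) = z ^ 12 \<Delta>(z)\<close> is obtained by comparing theta functions for the
lattices \<open>\<int> + \<int> z\<close> and \<open>\<int> + \<int> (- 1 / z)\<close>: both are determined up to a constant by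
their quasi-periods and their zero at the origin, and the product of the values at the three half
periods gives the cube of the constant. The quotient
\<open>(T\<^sub>p \<Delta> - \<tau>(p) \<Delta>) / \<Delta>\<close> is then an invariant function of \<open>q\<close> in the unit disc which vanishes at \<open>0\<close>,
and the maximum principle shows that it is zero.

The second fact is that \<open>\<tau>(n)\<close> is odd only for odd squares \<open>n\<close>
(\<open>odd_ramanujan_tau_imp_odd_square\<close>): modulo 2 the product is \<open>q (\<Prod>(1 - q ^ n) ^ 3) ^ 8\<close>, and
\<open>\<Prod>(1 - q ^ n) ^ 3\<close> is congruent to the generating function of the triangular numbers.\<close>

section \<open>Euler's product\<close>

lemma uniform_limit_prodinf_complex:
  fixes f :: "nat \<Rightarrow> complex \<Rightarrow> complex"
  assumes "compact K" and "\<And>n. continuous_on K (f n)" and "summable M"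
    and "\<And>n x. x \<in> K \<Longrightarrow> norm (f n x - 1) \<le> M n"
  shows "uniform_limit K (\<lambda>N x. \<Prod>n<N. f n x) (\<lambda>x. \<Prod>n. f n x) sequentially"
proof -
  have "uniform_limit K (\<lambda>N x. \<Sum>n<N. norm (f n x - 1)) (\<lambda>x. \<Sum>n. norm (f n x - 1)) sequentially"
    by (rule Weierstrass_m_test[OF _ assms(3)]) (use assms(4) in auto)
  then have "uniformly_convergent_on K (\<lambda>N x. \<Sum>n<N. norm (f n x - 1))"
    by (auto simp: uniformly_convergent_on_def)
  then have "uniformly_convergent_on K (\<lambda>N x. \<Prod>n<N. f n x)"
    using assms(1,2) by (intro uniformly_convergent_on_prod') auto
  then obtain g where g: "uniform_limit K (\<lambda>N x. \<Prod>n<N. f n x) g sequentially"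
    by (auto simp: uniformly_convergent_on_def)
  have "g x = (\<Prod>n. f n x)" if x: "x \<in> K" for x
  proof -
    have "summable (\<lambda>n. norm (f n x - 1))"
      by (rule summable_comparison_test'[OF assms(3), of 0]) (use assms(4) x in auto)
    then have "convergent_prod (\<lambda>n. f n x)"
      by (intro abs_convergent_prod_imp_convergent_prod summable_imp_abs_convergent_prod)
    then have "(\<lambda>N. \<Prod>n<N. f n x) \<longlonglongrightarrow> (\<Prod>n. f n x)"
      using has_prod_imp_tendsto' by blast
    moreover have "(\<lambda>N. \<Prod>n<N. f n x) \<longlonglongrightarrow> g x"
      using tendsto_uniform_limitI[OF g x] .
    ultimately show ?thesis by (rule LIMSEQ_unique[symmetric])
  qed
  then show ?thesis
    using g uniform_limit_cong'[of K "\<lambda>N x. \<Prod>n<N. f n x" "\<lambda>N x. \<Prod>n<N. f n x" g] by simp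
qed

definition euler_prod :: "complex \<Rightarrow> complex \<Rightarrow> complex" where
  "euler_prod q x = (\<Prod>n. 1 - q ^ Suc n * x)"

context
  fixes q :: complex
  assumes q: "norm q < 1"
begin

lemma convergent_euler_prod: "convergent_prod (\<lambda>n. 1 - q ^ Suc n * x)"
proof -
  have "summable (\<lambda>n. norm q ^ n * (norm q * norm x))"
    using q by (intro summable_mult2 summable_geometric) auto
  then have "summable (\<lambda>n. norm ((1 - q ^ Suc n * x) - 1))"
    by (simp add: norm_mult norm_power mult_ac)
  then show ?thesis
    by (intro abs_convergent_prod_imp_convergent_prod summable_imp_abs_convergent_prod)
qed

lemma has_prod_euler_prod: "(\<lambda>n. 1 - q ^ Suc n * x) has_prod euler_prod q x"
  unfolding euler_prod_def by (rule convergent_prod_has_prod[OF convergent_euler_prod])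

lemma euler_prod_LIMSEQ: "(\<lambda>N. \<Prod>n<N. 1 - q ^ Suc n * x) \<longlonglongrightarrow> euler_prod q x"
  using has_prod_imp_tendsto'[OF has_prod_euler_prod] .

lemma euler_prod_eq_0_iff: "euler_prod q x = 0 \<longleftrightarrow> (\<exists>n. q ^ Suc n * x = 1)"
  using has_prod_eq_0_iff[OF has_prod_euler_prod, of x] by auto

lemma euler_prod_shift: "euler_prod q x = (1 - q * x) * euler_prod q (q * x)"
proof (rule LIMSEQ_unique)
  have "(\<lambda>N. (1 - q * x) * (\<Prod>n<N. 1 - q ^ Suc n * (q * x))) \<longlonglongrightarrow> (1 - q * x) * euler_prod q (q * x)"
    by (intro tendsto_intros euler_prod_LIMSEQ)
  also have "(\<lambda>N. (1 - q * x) * (\<Prod>n<N. 1 - q ^ Suc n * (q * x))) = (\<lambda>N. \<Prod>n<Suc N. 1 - q ^ Suc n * x)"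
    by (subst prod.lessThan_Suc_shift) (simp add: mult_ac)
  finally show "(\<lambda>N. \<Prod>n<Suc N. 1 - q ^ Suc n * x) \<longlonglongrightarrow> (1 - q * x) * euler_prod q (q * x)" .
  show "(\<lambda>N. \<Prod>n<Suc N. 1 - q ^ Suc n * x) \<longlonglongrightarrow> euler_prod q x"
    using LIMSEQ_Suc[OF euler_prod_LIMSEQ] .
qed

lemma norm_sq_less_1: "norm (q\<^sup>2) < 1"
  using q by (simp add: norm_power power_less_one_iff)

lemma euler_prod_holomorphic: "euler_prod q holomorphic_on UNIV"
proof (rule holomorphic_uniform_sequence)
  show "(\<lambda>x. \<Prod>n<N. 1 - q ^ Suc n * x) holomorphic_on UNIV" for N
    by (intro holomorphic_intros)
  fix x :: complex
  have "uniform_limit (cball x 1) (\<lambda>N x. \<Prod>n<N. 1 - q ^ Suc n * x) (\<lambda>x. \<Prod>n. 1 - q ^ Suc n * x) sequentially"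
  proof (rule uniform_limit_prodinf_complex)
    show "summable (\<lambda>n. norm q ^ n * (norm q * (norm x + 1)))"
      using q by (intro summable_mult2 summable_geometric) auto
    fix n y assume y: "y \<in> cball x 1"
    then have "norm y \<le> norm x + 1"
      by (metis dist_norm mem_cball add.commute norm_triangle_sub norm_minus_commute add_left_mono order_trans)
    then show "norm (1 - q ^ Suc n * y - 1) \<le> norm q ^ n * (norm q * (norm x + 1))"
      by (auto simp: norm_mult norm_power mult_ac intro!: mult_left_mono mult_right_mono)
  qed (auto intro!: continuous_intros)
  then show "\<exists>d>0. cball x d \<subseteq> UNIV \<and>
      uniform_limit (cball x d) (\<lambda>N x. \<Prod>n<N. 1 - q ^ Suc n * x) (euler_prod q) sequentially"
    unfolding euler_prod_def[abs_def] by (intro exI[of _ 1]) auto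
qed auto

end

lemma euler_prod_1_nonzero:
  assumes "norm q < 1"
  shows "euler_prod q 1 \<noteq> 0"
proof -
  have "norm (q ^ Suc n) < 1" for n
    unfolding norm_power using assms by (subst power_less_one_iff) auto
  then have "q ^ Suc n \<noteq> 1" for n by (metis norm_one less_irrefl)
  then show ?thesis
    using euler_prod_eq_0_iff[OF assms, of 1] by (simp del: power_Suc)
qed

lemma euler_prod_compose_holomorphic [holomorphic_intros]:
  assumes "norm q < 1" "f holomorphic_on A"
  shows "(\<lambda>w. euler_prod q (f w)) holomorphic_on A"
  using holomorphic_on_compose[OF assms(2) holomorphic_on_subset[OF euler_prod_holomorphic[OF assms(1)]]]
  by (simp add: o_def)

text \<open>This and the next lemma combine to Euler's identity \<open>\<Prod>(1 + q ^ n) (1 - q ^ (2 n - 1)) = 1\<close>,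
which makes the infinite products cancel in the product of the half-period values of \<open>theta\<close>.\<close>

lemma euler_prod_mult_minus:
  assumes "norm q < 1"
  shows "euler_prod q x * euler_prod q (- x) = euler_prod (q\<^sup>2) (x\<^sup>2)"
proof (rule LIMSEQ_unique)
  show "(\<lambda>N. (\<Prod>n<N. 1 - q ^ Suc n * x) * (\<Prod>n<N. 1 - q ^ Suc n * (- x)))
      \<longlonglongrightarrow> euler_prod q x * euler_prod q (- x)"
    by (intro tendsto_mult euler_prod_LIMSEQ assms)
  have "(\<lambda>N. \<Prod>n<N. 1 - (q\<^sup>2) ^ Suc n * x\<^sup>2) \<longlonglongrightarrow> euler_prod (q\<^sup>2) (x\<^sup>2)"
    by (intro euler_prod_LIMSEQ norm_sq_less_1 assms)
  also have "(\<lambda>N. \<Prod>n<N. 1 - (q\<^sup>2) ^ Suc n * x\<^sup>2) =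
      (\<lambda>N. (\<Prod>n<N. 1 - q ^ Suc n * x) * (\<Prod>n<N. 1 - q ^ Suc n * (- x)))"
    by (intro ext, subst prod.distrib[symmetric], intro prod.cong refl)
       (simp add: algebra_simps power2_eq_square power_mult_distrib)
  finally show "(\<lambda>N. (\<Prod>n<N. 1 - q ^ Suc n * x) * (\<Prod>n<N. 1 - q ^ Suc n * (- x))) \<longlonglongrightarrow> euler_prod (q\<^sup>2) (x\<^sup>2)" .
qed

lemma euler_prod_even_odd:
  assumes "norm q < 1" "q \<noteq> 0"
  shows "euler_prod q 1 = euler_prod (q\<^sup>2) 1 * euler_prod (q\<^sup>2) (1 / q)"
proof (rule LIMSEQ_unique)
  have lim: "(\<lambda>N. \<Prod>n<N. 1 - (q\<^sup>2) ^ Suc n * x) \<longlonglongrightarrow> euler_prod (q\<^sup>2) x" for x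
    by (intro euler_prod_LIMSEQ norm_sq_less_1 assms)
  show "(\<lambda>N. (\<Prod>n<N. 1 - (q\<^sup>2) ^ Suc n * 1) * (\<Prod>n<N. 1 - (q\<^sup>2) ^ Suc n * (1 / q)))
      \<longlonglongrightarrow> euler_prod (q\<^sup>2) 1 * euler_prod (q\<^sup>2) (1 / q)"
    by (intro tendsto_mult lim)
  have "(\<Prod>n<2 * N. 1 - q ^ Suc n * 1) =
      (\<Prod>n<N. 1 - (q\<^sup>2) ^ Suc n * 1) * (\<Prod>n<N. 1 - (q\<^sup>2) ^ Suc n * (1 / q))" for N
  proof (induction N)
    case (Suc N)
    have "(q\<^sup>2) ^ Suc N * (1 / q) = q ^ Suc (2 * N)" "(q\<^sup>2) ^ Suc N = q ^ Suc (Suc (2 * N))"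
      using assms by (simp_all add: power_mult power2_eq_square)
    then show ?case
      using Suc.IH by (simp add: mult_ac del: power_Suc)
  qed simp
  moreover have "(\<lambda>N. \<Prod>n<2 * N. 1 - q ^ Suc n * 1) \<longlonglongrightarrow> euler_prod q 1"
    using LIMSEQ_subseq_LIMSEQ[OF euler_prod_LIMSEQ[OF assms(1), of 1], of "\<lambda>N. 2 * N"]
    by (simp add: strict_mono_def o_def)
  ultimately show "(\<lambda>N. (\<Prod>n<N. 1 - (q\<^sup>2) ^ Suc n * 1) * (\<Prod>n<N. 1 - (q\<^sup>2) ^ Suc n * (1 / q)))
      \<longlonglongrightarrow> euler_prod q 1"
    by simp
qed

lemma euler_prod_q_holomorphic: "(\<lambda>q. euler_prod q 1) holomorphic_on ball 0 1"
  and euler_prod_q_uniform_limit: "r < 1 \<Longrightarrow>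
    uniform_limit (cball 0 r) (\<lambda>N q. \<Prod>n<N. 1 - q ^ Suc n) (\<lambda>q. euler_prod q 1) sequentially"
proof -
  have ul: "uniform_limit (cball 0 r) (\<lambda>N q. \<Prod>n<N. 1 - q ^ Suc n) (\<lambda>q. euler_prod q 1) sequentially"
    if "r < 1" for r :: real
    unfolding euler_prod_def mult_1_right
  proof (rule uniform_limit_prodinf_complex)
    \<comment> \<open>for \<open>r < 0\<close> the disc is empty, but the majorant must still be summable\<close>
    show "summable (\<lambda>n. max r 0 ^ Suc n)"
      using \<open>r < 1\<close> by (subst summable_Suc_iff) (intro summable_geometric, auto)
    fix n and q :: complex assume "q \<in> cball 0 r"
    then show "norm (1 - q ^ Suc n - 1) \<le> max r 0 ^ Suc n"
      by (simp add: norm_power power_mono del: power_Suc)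
  qed (auto intro!: continuous_intros)
  show "r < 1 \<Longrightarrow> uniform_limit (cball 0 r) (\<lambda>N q. \<Prod>n<N. 1 - q ^ Suc n) (\<lambda>q. euler_prod q 1) sequentially"
    by (rule ul)
  show "(\<lambda>q. euler_prod q 1) holomorphic_on ball 0 1"
  proof (rule holomorphic_uniform_sequence)
    show "(\<lambda>q. \<Prod>n<N. 1 - q ^ Suc n) holomorphic_on ball 0 1" for N
      by (intro holomorphic_intros)
    fix q :: complex assume "q \<in> ball 0 1"
    then have q: "norm q < 1" by simp
    define r where "r = (1 + norm q) / 2"
    have sub: "cball q (r - norm q) \<subseteq> cball 0 r"
      by (auto simp: dist_norm) (smt (verit) norm_triangle_sub norm_minus_commute)
    moreover have "r < 1" using q by (simp add: r_def)
    ultimately have "uniform_limit (cball q (r - norm q)) (\<lambda>N q. \<Prod>n<N. 1 - q ^ Suc n) (\<lambda>q. euler_prod q 1) sequentially"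
      using ul uniform_limit_on_subset by blast
    moreover have "cball 0 r \<subseteq> ball (0::complex) 1" using \<open>r < 1\<close> by auto
    moreover have "r - norm q > 0" using q by (simp add: r_def)
    ultimately show "\<exists>d>0. cball q d \<subseteq> ball 0 1 \<and>
        uniform_limit (cball q d) (\<lambda>N q. \<Prod>n<N. 1 - q ^ Suc n) (\<lambda>q. euler_prod q 1) sequentially"
      using sub by blast
  qed auto
qed

section \<open>A theta function\<close>

text \<open>Written in terms of \<open>expi\<close>, the nome is \<open>expi (2 * z)\<close>, and all half-integral powers of it are
unambiguous functions of \<open>z\<close>.\<close>

definition expi :: "complex \<Rightarrow> complex" where "expi w = exp (\<i> * of_real pi * w)"

lemma expi_add: "expi (v + w) = expi v * expi w"
  by (simp add: expi_def exp_add algebra_simps)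

lemma expi_diff: "expi (v - w) = expi v / expi w"
  by (simp add: expi_def exp_diff algebra_simps)

lemma expi_minus: "expi (- w) = inverse (expi w)"
  by (simp add: expi_def exp_minus)

lemma expi_nonzero [simp]: "expi w \<noteq> 0"
  by (simp add: expi_def)

lemma expi_0 [simp]: "expi 0 = 1"
  by (simp add: expi_def)

lemma expi_1 [simp]: "expi 1 = -1"
  by (simp add: expi_def mult.commute)

lemma expi_half [simp]: "expi (1 / 2) = \<i>"
  using exp_pi_i' exp_Euler[of "of_real pi / 2"] by (simp add: expi_def)

lemma expi_power: "expi w ^ n = expi (of_nat n * w)"
  by (simp add: expi_def exp_of_nat_mult [symmetric] algebra_simps)

lemma expi_double: "expi (2 * w) = (expi w)\<^sup>2"
  by (simp add: expi_power)

lemma expi_eq_1_iff: "expi (2 * w) = 1 \<longleftrightarrow> w \<in> \<int>"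
proof -
  have "expi (2 * w) = 1 \<longleftrightarrow> Im w = 0 \<and> (\<exists>n::int. Re w = of_int n)"
    by (auto simp: expi_def exp_eq_1)
  also have "\<dots> \<longleftrightarrow> w \<in> \<int>"
    by (auto simp: complex_is_Int_iff)
  finally show ?thesis .
qed

lemma norm_expi: "norm (expi w) = exp (- pi * Im w)"
  by (simp add: expi_def)

lemma norm_nome_less_1: "Im z > 0 \<Longrightarrow> norm (expi (2 * z)) < 1"
  by (simp add: norm_expi)

lemma expi_holomorphic [holomorphic_intros]:
  "f holomorphic_on A \<Longrightarrow> (\<lambda>w. expi (f w)) holomorphic_on A"
  unfolding expi_def by (intro holomorphic_intros)

text \<open>Up to the factor \<open>q ^ (1/8) \<Prod>(1 - q ^ n)\<close> and a constant this is Jacobi's first theta function.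
It is defined as a product because this displays its zeros, which are the points of the lattice
\<open>\<int> + \<int> z\<close>.\<close>

definition theta :: "complex \<Rightarrow> complex \<Rightarrow> complex" where
  "theta z w = (expi w - expi (- w)) *
     euler_prod (expi (2 * z)) (expi (2 * w)) * euler_prod (expi (2 * z)) (expi (- (2 * w)))"

lemma theta_minus: "theta z (- w) = - theta z w"
  by (simp add: theta_def algebra_simps)

lemma theta_add_1: "theta z (w + 1) = - theta z w"
proof -
  have two: "expi 2 = 1" using expi_double[of 1] by simp
  have "2 * (w + 1) = 2 * w + 2" "- (2 * (w + 1)) = - (2 * w) - 2" "- (w + 1) = - w - 1"
    by simp_all
  then show ?thesis
    by (simp only: theta_def expi_add expi_diff two expi_1) (simp add: left_diff_distrib)
qed

lemma theta_add_period:
  assumes "Im z > 0"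
  shows "theta z (w + z) = - expi (- (2 * w) - z) * theta z w"
proof -
  define q where "q = expi (2 * z)"
  define x where "x = expi w"
  define y where "y = expi z"
  have q: "norm q < 1" using norm_nome_less_1[OF assms] by (simp add: q_def)
  have nz: "x \<noteq> 0" "y \<noteq> 0" by (simp_all add: x_def y_def)
  have qy: "q = y\<^sup>2" by (simp add: q_def y_def expi_double)
  have a: "euler_prod q (x\<^sup>2) = (1 - q * x\<^sup>2) * euler_prod q (q * x\<^sup>2)"
    by (rule euler_prod_shift[OF q])
  have b: "euler_prod q (1 / (q * x\<^sup>2)) = (1 - 1 / x\<^sup>2) * euler_prod q (1 / x\<^sup>2)"
    using euler_prod_shift[OF q, of "1 / (q * x\<^sup>2)"] nz qy by simp
  have e: "expi (w + z) = x * y" "expi (- (w + z)) = 1 / (x * y)" "expi (2 * (w + z)) = q * x\<^sup>2"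
    "expi (- (2 * (w + z))) = 1 / (q * x\<^sup>2)" "expi (- (2 * w)) = 1 / x\<^sup>2" "expi (2 * w) = x\<^sup>2"
    "expi (- w) = 1 / x" "expi (- (2 * w) - z) = 1 / (x\<^sup>2 * y)"
    by (simp_all add: expi_minus expi_add expi_diff expi_double expi_double[unfolded mult.commute[of 2]]
        x_def y_def q_def field_simps)
  have "theta z (w + z) = (x * y - 1 / (x * y)) * euler_prod q (q * x\<^sup>2) * euler_prod q (1 / (q * x\<^sup>2))"
    by (simp only: theta_def q_def[symmetric] e)
  also have "\<dots> = - (1 / (x\<^sup>2 * y)) * ((x - 1 / x) * ((1 - q * x\<^sup>2) * euler_prod q (q * x\<^sup>2)) * euler_prod q (1 / x\<^sup>2))"
    unfolding b using nz by (simp add: qy field_simps power2_eq_square)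
  also have "\<dots> = - (1 / (x\<^sup>2 * y)) * ((x - 1 / x) * euler_prod q (x\<^sup>2) * euler_prod q (1 / x\<^sup>2))"
    unfolding a ..
  also have "\<dots> = - expi (- (2 * w) - z) * theta z w"
    by (simp only: theta_def q_def[symmetric] e x_def[symmetric])
  finally show ?thesis .
qed

lemma theta_eq_0_iff:
  assumes "Im z > 0"
  shows "theta z w = 0 \<longleftrightarrow> (\<exists>m n :: int. w = of_int m + of_int n * z)"
proof -
  have q: "norm (expi (2 * z)) < 1" by (rule norm_nome_less_1[OF assms])
  have "expi w - expi (- w) = 0 \<longleftrightarrow> expi (2 * w) = 1"
    by (simp only: expi_minus expi_double) (simp add: field_simps power2_eq_square)
  moreover have "expi (2 * z) ^ Suc n * expi (2 * w) = expi (2 * (of_nat (Suc n) * z + w))" for n w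
    by (simp only: expi_power expi_add[symmetric] ring_distribs mult_ac add_ac)
  moreover have "expi (2 * z) ^ Suc n * expi (- (2 * w)) = expi (2 * (of_nat (Suc n) * z - w))" for n w
    by (simp only: expi_power expi_add[symmetric] ring_distribs mult_ac add_ac
        diff_conv_add_uminus mult_minus_right mult_minus_left)
  ultimately have iff: "theta z w = 0 \<longleftrightarrow> w \<in> \<int> \<or> (\<exists>n. of_nat (Suc n) * z + w \<in> \<int>) \<or> (\<exists>n. of_nat (Suc n) * z - w \<in> \<int>)"
    by (simp only: theta_def mult_eq_0_iff euler_prod_eq_0_iff[OF q] expi_eq_1_iff disj_assoc)
  show ?thesis
  proof
    assume "theta z w = 0"
    then consider "w \<in> \<int>" | n where "of_nat (Suc n) * z + w \<in> \<int>" | n where "of_nat (Suc n) * z - w \<in> \<int>"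
      using iff by blast
    then show "\<exists>m n :: int. w = of_int m + of_int n * z"
    proof cases
      case 1
      then obtain m where "w = of_int m" by (auto elim: Ints_cases)
      then show ?thesis by (intro exI[of _ m] exI[of _ 0]) simp
    next
      case (2 n)
      then obtain m where "of_nat (Suc n) * z + w = of_int m" by (auto elim: Ints_cases)
      then show ?thesis by (intro exI[of _ m] exI[of _ "- int (Suc n)"]) (simp add: algebra_simps)
    next
      case (3 n)
      then obtain m where "of_nat (Suc n) * z - w = of_int m" by (auto elim: Ints_cases)
      then show ?thesis by (intro exI[of _ "-m"] exI[of _ "int (Suc n)"]) (simp add: algebra_simps)
    qed
  next
    assume "\<exists>m n :: int. w = of_int m + of_int n * z"
    then obtain m n :: int where w: "w = of_int m + of_int n * z" by blast
    consider "n = 0" | k where "n = int (Suc k)" | k where "n = - int (Suc k)"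
      by (metis int_cases nat.exhaust of_nat_0)
    then show "theta z w = 0"
    proof cases
      case 1
      then show ?thesis using w iff by simp
    next
      case (2 k)
      have "of_nat (Suc k) * z - w = of_int (- m)" unfolding w 2 by simp
      then show ?thesis using iff Ints_of_int by metis
    next
      case (3 k)
      have "of_nat (Suc k) * z + w = of_int m" unfolding w 3 by (simp add: algebra_simps)
      then show ?thesis using iff Ints_of_int by metis
    qed
  qed
qed

lemma theta_holomorphic:
  assumes "Im z > 0"
  shows "theta z holomorphic_on UNIV"
  unfolding theta_def[abs_def] by (intro holomorphic_intros norm_nome_less_1 assms)

text \<open>The twelfth power of the squared Euler product is the discriminant divided by the nome.\<close>

lemma theta_deriv_0:
  assumes "Im z > 0"
  shows "(theta z has_field_derivative 2 * \<i> * of_real pi * (euler_prod (expi (2 * z)) 1)\<^sup>2) (at 0)"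
proof -
  let ?Q = "\<lambda>w. euler_prod (expi (2 * z)) (expi (2 * w)) * euler_prod (expi (2 * z)) (expi (- (2 * w)))"
  have "?Q holomorphic_on UNIV"
    by (intro holomorphic_intros norm_nome_less_1 assms)
  then obtain D where D: "(?Q has_field_derivative D) (at 0)"
    by (auto simp: holomorphic_on_def field_differentiable_def)
  have "((\<lambda>w. expi w - expi (- w)) has_field_derivative 2 * \<i> * of_real pi) (at 0)"
    unfolding expi_def by (auto intro!: derivative_eq_intros)
  from DERIV_mult[OF this D] show ?thesis
    by (simp add: theta_def[abs_def] mult.assoc power2_eq_square)
qed

section \<open>Uniqueness of functions with given quasi-periods\<close>

lemma periodic_int_multiple:
  fixes f :: "complex \<Rightarrow> 'a"
  assumes "\<And>w. f (w + c) = f w"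
  shows "f (w + of_int n * c) = f w"
proof (induction n arbitrary: w rule: int_induct[where k = 0])
  case (step1 i)
  then show ?case using assms[of "w + of_int i * c"] by (simp add: algebra_simps)
next
  case (step2 i)
  then show ?case using assms[of "w + of_int (i - 1) * c"] by (simp add: algebra_simps)
qed simp

text \<open>Every value is attained on the compact period parallelogram, so Liouville's theorem applies.\<close>

lemma entire_doubly_periodic_const:
  fixes f :: "complex \<Rightarrow> complex"
  assumes holo: "f holomorphic_on UNIV" and z: "Im z > 0"
    and per: "\<And>w. f (w + 1) = f w" "\<And>w. f (w + z) = f w"
  shows "f w = f 0"
proof -
  have int1: "f (w + of_int n) = f w" and intz: "f (w + of_int n * z) = f w" for w n
    using periodic_int_multiple[of f 1, OF per(1)] periodic_int_multiple[of f z, OF per(2)] by simp_all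
  define K where "K = (\<lambda>(s, t). of_real s + of_real t * z) ` ({0..1} \<times> {0..1})"
  have "compact K"
    unfolding K_def by (intro compact_continuous_image compact_Times)
       (auto simp: case_prod_unfold intro!: continuous_intros)
  then have "bounded (f ` K)"
    using holo by (meson compact_continuous_image compact_imp_bounded continuous_on_subset
        holomorphic_on_imp_continuous_on subset_UNIV)
  moreover have "range f \<subseteq> f ` K"
  proof safe
    fix w
    define t where "t = Im w / Im z"
    define s where "s = Re (w - of_real t * z)"
    have w: "w = of_real s + of_real t * z"
      using z by (simp add: complex_eq_iff s_def t_def)
    have "f w = f (of_real (frac s) + of_real (frac t) * z + of_int \<lfloor>s\<rfloor> + of_int \<lfloor>t\<rfloor> * z)"
      by (subst w, rule arg_cong[of _ _ f]) (simp add: frac_def algebra_simps)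
    also have "\<dots> = f (of_real (frac s) + of_real (frac t) * z)"
      by (simp only: int1 intz)
    moreover have "of_real (frac s) + of_real (frac t) * z \<in> K"
      unfolding K_def by (intro image_eqI[of _ _ "(frac s, frac t)"]) (auto simp: frac_lt_1 less_imp_le)
    ultimately show "f w \<in> f ` K" by simp
  qed
  ultimately have "bounded (range f)" by (rule bounded_subset)
  from Liouville_theorem[OF holo this] show ?thesis
    by (auto simp: constant_on_def)
qed

lemma theta_diff_1: "theta z (w - 1) = - theta z w"
  using theta_add_1[of z "w - 1"] by auto

text \<open>The quotient of \<open>G\<close> and \<open>theta z\<close> is doubly periodic. As \<open>theta z\<close> has zeros only at the lattice
points, with non-vanishing derivative at \<open>0\<close>, and \<open>G\<close> vanishes there too, the quotient extends to an
entire function. It is therefore constant, and its value is the quotient of the derivatives at \<open>0\<close>.\<close>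

lemma theta_quasi_unique:
  assumes z: "Im z > 0" and G: "G holomorphic_on UNIV"
    and G0: "G 0 = 0" "(G has_field_derivative D) (at 0)"
    and per: "\<And>w. G (w + 1) = - G w" "\<And>w. G (w + z) = - expi (- (2 * w) - z) * G w"
  shows "G w = D / (2 * \<i> * of_real pi * (euler_prod (expi (2 * z)) 1)\<^sup>2) * theta z w"
proof -
  define D0 where "D0 = 2 * \<i> * of_real pi * (euler_prod (expi (2 * z)) 1)\<^sup>2"
  have D0: "D0 \<noteq> 0"
    using euler_prod_1_nonzero[OF norm_nome_less_1[OF z]] by (simp add: D0_def)
  define L where "L = {w. \<exists>m n :: int. w = of_int m + of_int n * z}"
  have zero: "theta z w = 0 \<longleftrightarrow> w \<in> L" for w
    using theta_eq_0_iff[OF z] by (simp add: L_def)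
  have L: "w + 1 \<in> L \<longleftrightarrow> w \<in> L" "w + z \<in> L \<longleftrightarrow> w \<in> L" for w
    using zero[of "w + 1"] zero[of "w + z"] zero[of w] theta_add_1[of z w] theta_add_period[OF z, of w] by auto
  \<comment> \<open>the value at lattice points is the limit of the quotient there\<close>
  define f where "f w = (if w \<in> L then D / D0 else G w / theta z w)" for w
  have f1: "f (w + 1) = f w" and fz: "f (w + z) = f w" for w
    using L[of w] zero[of w] by (auto simp: f_def per theta_add_1 theta_add_period[OF z])
  have f_int1: "f (w + of_int n) = f w" and f_intz: "f (w + of_int n * z) = f w" for w n
    using periodic_int_multiple[of f 1, OF f1] periodic_int_multiple[of f z, OF fz] by simp_all
  have open_L: "open (- L)"
  proof -
    have "- L = {w. theta z w \<noteq> 0}" using zero by auto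
    moreover have "continuous_on UNIV (theta z)"
      using theta_holomorphic[OF z] by (rule holomorphic_on_imp_continuous_on)
    ultimately show ?thesis
      by (simp add: open_Collect_neq continuous_on_const)
  qed
  have f_L: "f holomorphic_on - L"
  proof (rule holomorphic_transform)
    show "(\<lambda>w. G w / theta z w) holomorphic_on - L"
      by (intro holomorphic_intros holomorphic_on_subset[OF G] holomorphic_on_subset[OF theta_holomorphic[OF z]])
         (auto simp: zero)
  qed (simp add: f_def)
  have "theta z 0 = 0" using theta_minus[of z 0] by simp
  then have "0 \<in> L" using zero by simp
  have nz_near: "eventually (\<lambda>w. theta z w \<noteq> 0) (at 0)"
  proof -
    have "((\<lambda>w. theta z w / w) \<longlongrightarrow> D0) (at 0)"
      using theta_deriv_0[OF z] \<open>theta z 0 = 0\<close> by (simp add: has_field_derivative_iff D0_def)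
    then have "eventually (\<lambda>w. theta z w / w \<noteq> 0) (at 0)"
      using D0 by (rule tendsto_imp_eventually_ne)
    then show ?thesis by eventually_elim auto
  qed
  have lim: "(f \<longlongrightarrow> D / D0) (at 0)"
  proof -
    have "((\<lambda>w. (G w / w) / (theta z w / w)) \<longlongrightarrow> D / D0) (at 0)"
      using G0 theta_deriv_0[OF z] \<open>theta z 0 = 0\<close> D0
      by (intro tendsto_divide) (simp_all add: has_field_derivative_iff D0_def)
    moreover from nz_near have "eventually (\<lambda>w. (G w / w) / (theta z w / w) = f w) (at 0)"
      using eventually_neq_at_within[of 0 0 UNIV]
      by eventually_elim (auto simp: f_def zero)
    ultimately show ?thesis by (rule Lim_transform_eventually)
  qed
  have f_0: "f field_differentiable at 0"
  proof -
    from nz_near obtain r where r: "r > 0" "\<And>w. w \<in> ball 0 r - {0} \<Longrightarrow> w \<notin> L"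
      by (auto simp: eventually_at zero dist_commute)
    have "f holomorphic_on ball 0 r"
    proof (rule no_isolated_singularity')
      show "f holomorphic_on ball 0 r - {0}"
        by (rule holomorphic_on_subset[OF f_L]) (use r(2) in blast)
      fix x :: complex assume "x \<in> {0}"
      then show "(f \<longlongrightarrow> f x) (at x within ball 0 r)"
        using lim \<open>0 \<in> L\<close> tendsto_within_subset[of f _ 0 UNIV] by (auto simp: f_def)
    qed auto
    then show ?thesis using r(1) holomorphic_on_imp_differentiable_at[of f "ball 0 r" 0] by simp
  qed
  have "f holomorphic_on UNIV"
    unfolding holomorphic_on_def
  proof
    fix a
    show "f field_differentiable at a within UNIV"
    proof (cases "a \<in> L")
      case False
      then show ?thesis
        using holomorphic_on_imp_differentiable_at[OF f_L open_L] by simp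
    next
      case True
      then obtain m n :: int where a: "a = of_int m + of_int n * z" by (auto simp: L_def)
      have shift: "f w = f (w - a)" for w
        using f_int1[of "w - a + of_int n * z" m] f_intz[of "w - a" n] by (simp add: a algebra_simps)
      have "(f \<circ> (\<lambda>w. w - a)) field_differentiable at a"
        by (rule field_differentiable_compose) (use f_0 in \<open>auto intro!: derivative_intros\<close>)
      moreover have "f \<circ> (\<lambda>w. w - a) = f" using shift by (auto simp: fun_eq_iff)
      ultimately show ?thesis by simp
    qed
  qed
  then have const: "f w = D / D0" for w
    using entire_doubly_periodic_const[OF _ z f1 fz, of w] \<open>0 \<in> L\<close> by (simp add: f_def[of 0])
  have "G w = D / D0 * theta z w" if "w \<notin> L" for w
    using const[of w] that zero[of w] by (simp add: f_def field_simps)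
  moreover have "G w = 0" if wL: "w \<in> L" for w
  proof -
    obtain m n :: int where w: "w = of_int m + of_int n * z" using wL by (auto simp: L_def)
    have 1: "G (v + of_int k) = 0 \<longleftrightarrow> G v = 0" and 2: "G (v + of_int k * z) = 0 \<longleftrightarrow> G v = 0" for v k
      using periodic_int_multiple[of "\<lambda>w. G w = 0" 1] periodic_int_multiple[of "\<lambda>w. G w = 0" z]
      by (simp_all add: per)
    show ?thesis using 1[of 0 m] 2[of "of_int m" n] G0(1) by (simp add: w)
  qed
  ultimately show ?thesis using zero[of w] by (cases "w \<in> L") (auto simp: D0_def)
qed

section \<open>The discriminant under inversion\<close>

text \<open>Each factor is the square of an Euler product times an elementary term; the three Euler products
multiply to \<open>1\<close>.\<close>

lemma theta_half_period_product:
  assumes z: "Im z > 0"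
  shows "theta z (1 / 2) * theta z (z / 2) * theta z ((1 + z) / 2) = 2 / expi z"
proof -
  define q where "q = expi (2 * z)"
  define r where "r = expi z"
  define s where "s = expi (z / 2)"
  have q: "norm q < 1" using norm_nome_less_1[OF z] by (simp add: q_def)
  have nz: "q \<noteq> 0" "r \<noteq> 0" "s \<noteq> 0" by (simp_all add: q_def r_def s_def)
  have qr: "q = r\<^sup>2" by (simp add: q_def r_def expi_double)
  have rs: "r = s\<^sup>2" using expi_double[of "z / 2"] by (simp add: r_def s_def)
  let ?Q = "euler_prod q"
  have a: "?Q (1 / r) * ?Q (- (1 / r)) = euler_prod (q\<^sup>2) (1 / q)"
    using euler_prod_mult_minus[OF q, of "1 / r"] by (simp add: qr power_divide)
  have b: "?Q 1 * ?Q (-1) = euler_prod (q\<^sup>2) 1"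
    using euler_prod_mult_minus[OF q, of 1] by simp
  have c: "?Q 1 = euler_prod (q\<^sup>2) 1 * euler_prod (q\<^sup>2) (1 / q)"
    by (rule euler_prod_even_odd[OF q nz(1)])
  have "?Q 1 * (?Q (-1) * ?Q (1 / r) * ?Q (- (1 / r))) =
      (?Q 1 * ?Q (-1)) * (?Q (1 / r) * ?Q (- (1 / r)))"
    by (simp only: mult_ac)
  also have "\<dots> = ?Q 1"
    unfolding a b by (rule c[symmetric])
  finally have "?Q 1 * (?Q (-1) * ?Q (1 / r) * ?Q (- (1 / r))) = ?Q 1" .
  moreover have "?Q 1 \<noteq> 0"
    by (rule euler_prod_1_nonzero[OF q])
  ultimately have one: "?Q (-1) * ?Q (1 / r) * ?Q (- (1 / r)) = 1"
    by (metis mult_cancel_left2)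
  have m: "?Q (1 / r) = (1 - r) * ?Q r" "?Q (- (1 / r)) = (1 + r) * ?Q (- r)"
    using euler_prod_shift[OF q, of "1 / r"] euler_prod_shift[OF q, of "- (1 / r)"] nz
    by (simp_all add: qr power2_eq_square)
  have "theta z (1 / 2) = 2 * \<i> * (?Q (-1))\<^sup>2"
    by (simp add: theta_def q_def expi_minus power2_eq_square)
  moreover have "theta z (z / 2) = - (1 / s) * (?Q (1 / r))\<^sup>2"
  proof -
    have "theta z (z / 2) = (s - 1 / s) * ?Q r * ?Q (1 / r)"
      by (simp add: theta_def q_def[symmetric] s_def r_def expi_minus inverse_eq_divide)
    also have "\<dots> = - (1 / s) * ((1 - r) * ?Q r) * ?Q (1 / r)"
      using nz by (simp add: rs field_simps power2_eq_square)
    finally show ?thesis by (simp add: m(1)[symmetric] power2_eq_square)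
  qed
  moreover have "theta z ((1 + z) / 2) = \<i> / s * (?Q (- (1 / r)))\<^sup>2"
  proof -
    have e1: "expi ((1 + z) / 2) = \<i> * s"
      by (simp add: add_divide_distrib expi_add s_def)
    have e2: "expi (- ((1 + z) / 2)) = 1 / (\<i> * s)"
      by (simp only: expi_minus e1 inverse_eq_divide)
    have "2 * ((1 + z) / 2) = 1 + z" by (simp add: field_simps)
    then have e3: "expi (2 * ((1 + z) / 2)) = - r"
      by (simp only: expi_add expi_1 r_def) simp
    have e4: "expi (- (2 * ((1 + z) / 2))) = - (1 / r)"
      unfolding expi_minus e3 by (simp add: inverse_eq_divide)
    have "theta z ((1 + z) / 2) = (\<i> * s - 1 / (\<i> * s)) * ?Q (- r) * ?Q (- (1 / r))"
      unfolding theta_def q_def[symmetric] e1 e2 e3 e4 ..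
    also have "\<dots> = \<i> / s * ((1 + r) * ?Q (- r)) * ?Q (- (1 / r))"
      using nz by (simp add: rs field_simps power2_eq_square)
    finally show ?thesis by (simp add: m(2)[symmetric] power2_eq_square)
  qed
  ultimately have "theta z (1 / 2) * theta z (z / 2) * theta z ((1 + z) / 2) =
      (2 * \<i> * (- (1 / s)) * (\<i> / s)) * (?Q (-1) * ?Q (1 / r) * ?Q (- (1 / r)))\<^sup>2"
    by (simp only: power_mult_distrib mult_ac)
  also have "\<dots> = 2 / r"
    unfolding one using nz by (simp add: rs field_simps power2_eq_square)
  finally show ?thesis by (simp add: r_def)
qed

definition Delta_q :: "complex \<Rightarrow> complex" where
  "Delta_q q = q * euler_prod q 1 ^ 24"

text \<open>The function \<open>G w = expi (- w\<^sup>2 / z) * theta (- 1 / z) (w / z)\<close> has the quasi-periods of \<open>theta z\<close>, so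
\<open>G = K * theta z\<close>, where \<open>K\<close> is \<open>1 / z\<close> times the quotient of the squared Euler products. Division by
\<open>z\<close> permutes the half periods, so multiplying the equation at these three points evaluates \<open>K ^ 3\<close>
as an elementary expression. The fourth power of the result is the claim.\<close>

lemma Delta_q_inversion:
  assumes z: "Im z > 0"
  shows "Delta_q (expi (2 * (- 1 / z))) = z ^ 12 * Delta_q (expi (2 * z))"
proof -
  define z' where "z' = - 1 / z"
  have z0: "z \<noteq> 0" using z by auto
  have z': "Im z' > 0"
    using z by (simp add: z'_def Im_divide sum_power2_gt_zero_iff)
  define G where "G w = expi (w\<^sup>2 * z') * theta z' (w / z)" for w
  define P where "P = euler_prod (expi (2 * z)) 1"
  define P' where "P' = euler_prod (expi (2 * z')) 1"
  have P0: "P \<noteq> 0"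
    unfolding P_def by (rule euler_prod_1_nonzero[OF norm_nome_less_1[OF z]])
  have Gh: "G holomorphic_on UNIV"
  proof -
    have "(\<lambda>w. theta z' (w / z)) holomorphic_on UNIV"
      using holomorphic_on_compose[OF _ holomorphic_on_subset[OF theta_holomorphic[OF z']], of "\<lambda>w. w / z" UNIV] z0
      by (simp add: o_def holomorphic_intros)
    then show ?thesis unfolding G_def by (intro holomorphic_intros)
  qed
  have G1: "G (w + 1) = - G w" for w
  proof -
    define u where "u = (w + 1) / z"
    have "theta z' (w / z) = theta z' (u + z')"
      by (rule arg_cong[of _ _ "theta z'"]) (use z0 in \<open>simp add: u_def z'_def field_simps\<close>)
    also have "\<dots> = - expi (- (2 * u) - z') * theta z' u" by (rule theta_add_period[OF z'])
    finally have "- G w = (expi (w\<^sup>2 * z') * expi (- (2 * u) - z')) * theta z' u"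
      by (simp add: G_def)
    also have "expi (w\<^sup>2 * z') * expi (- (2 * u) - z') = expi ((w + 1)\<^sup>2 * z')"
      unfolding expi_add[symmetric] using z0
      by (intro arg_cong[of _ _ expi]) (simp add: u_def z'_def field_simps power2_eq_square)
    finally show ?thesis by (simp add: G_def u_def)
  qed
  have Gz: "G (w + z) = - expi (- (2 * w) - z) * G w" for w
  proof -
    have "G (w + z) = expi ((w + z)\<^sup>2 * z') * theta z' (w / z + 1)"
      using z0 by (simp add: G_def add_divide_distrib)
    also have "expi ((w + z)\<^sup>2 * z') = expi (- (2 * w) - z) * expi (w\<^sup>2 * z')"
      unfolding expi_add[symmetric] using z0
      by (intro arg_cong[of _ _ expi]) (simp add: z'_def field_simps power2_eq_square)
    finally show ?thesis by (simp add: theta_add_1 G_def)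
  qed
  have th0: "theta z' 0 = 0" using theta_minus[of z' 0] by simp
  have dG: "(G has_field_derivative 2 * \<i> * of_real pi * P'\<^sup>2 / z) (at 0)"
  proof -
    have "((\<lambda>w. w / z) has_field_derivative 1 / z) (at 0)"
      using z0 by (auto intro!: derivative_eq_intros)
    then have th: "((\<lambda>w. theta z' (w / z)) has_field_derivative 2 * \<i> * of_real pi * P'\<^sup>2 * (1 / z)) (at 0)"
      using DERIV_chain[of "theta z'" _ "\<lambda>w. w / z" 0 "1 / z" UNIV] theta_deriv_0[OF z']
      by (simp add: o_def P'_def)
    have ex: "((\<lambda>w. expi (w\<^sup>2 * z')) has_field_derivative 0) (at 0)"
      unfolding expi_def by (auto intro!: derivative_eq_intros)
    show ?thesis
      using DERIV_mult[OF ex th] by (simp add: G_def[abs_def] th0)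
  qed
  define K where "K = P'\<^sup>2 / (z * P\<^sup>2)"
  have GK: "G w = K * theta z w" for w
  proof -
    have "G w = (2 * \<i> * of_real pi * P'\<^sup>2 / z) / (2 * \<i> * of_real pi * P\<^sup>2) * theta z w"
      unfolding P_def by (rule theta_quasi_unique[OF z Gh _ dG G1 Gz]) (simp add: G_def th0)
    then show ?thesis by (simp add: K_def)
  qed
  have h1: "G (1 / 2) = - expi (z' / 4) * theta z' (z' / 2)"
  proof -
    have "(1 / 2) / z = - (z' / 2)" "(1 / 2)\<^sup>2 * z' = z' / 4"
      using z0 by (simp_all add: z'_def power2_eq_square)
    then show ?thesis by (simp only: G_def theta_minus) simp
  qed
  have h2: "G (z / 2) = expi (- (z / 4)) * theta z' (1 / 2)"
  proof -
    have "(z / 2) / z = 1 / 2" "(z / 2)\<^sup>2 * z' = - (z / 4)"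
      using z0 by (simp_all add: z'_def power2_eq_square)
    then show ?thesis by (simp only: G_def)
  qed
  have h3: "G ((1 + z) / 2) = - \<i> * expi (z' / 4) * expi (- (z / 4)) * theta z' ((1 + z') / 2)"
  proof -
    have a: "((1 + z) / 2) / z = - (((1 + z') / 2) - 1)" 
      using z0 by (simp add: z'_def field_simps)
    have b: "((1 + z) / 2)\<^sup>2 * z' = z' / 4 + - (z / 4) - 1 / 2"
      using z0 by (simp add: z'_def field_simps power2_eq_square)
    have "expi (((1 + z) / 2)\<^sup>2 * z') = - \<i> * expi (z' / 4) * expi (- (z / 4))"
      by (simp only: b expi_add expi_diff) simp
    moreover have "theta z' (((1 + z) / 2) / z) = theta z' ((1 + z') / 2)"
      by (simp only: a theta_minus theta_diff_1) simp
    ultimately show ?thesis by (simp only: G_def)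
  qed
  have "K ^ 3 * (theta z (1 / 2) * theta z (z / 2) * theta z ((1 + z) / 2)) =
      G (1 / 2) * G (z / 2) * G ((1 + z) / 2)"
    by (simp add: GK power3_eq_cube)
  also have "\<dots> = \<i> * (expi (z' / 4) * expi (- (z / 4)))\<^sup>2 *
      (theta z' (1 / 2) * theta z' (z' / 2) * theta z' ((1 + z') / 2))"
    by (simp add: h1 h2 h3 power2_eq_square)
  finally have "K ^ 3 * (2 / expi z) = \<i> * (expi (z' / 4) * expi (- (z / 4)))\<^sup>2 * (2 / expi z')"
    by (simp only: theta_half_period_product[OF z] theta_half_period_product[OF z'])
  then have "K ^ 3 * (2 / expi z) * (expi z / 2) =
      \<i> * (expi (z' / 4) * expi (- (z / 4)))\<^sup>2 * (2 / expi z') * (expi z / 2)"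
    by (rule arg_cong)
  then have K3: "K ^ 3 = \<i> * (expi (z' / 4) * expi (- (z / 4)))\<^sup>2 * expi z / expi z'"
    by simp
  have "K ^ 12 = (K ^ 3) ^ 4" by (simp add: power_mult[symmetric])
  also have "\<dots> = \<i> ^ 4 * ((expi (z' / 4) * expi (- (z / 4))) ^ 8 * expi z ^ 4 / expi z' ^ 4)"
    by (simp add: K3 power_mult_distrib power_divide power_mult[symmetric])
  also have "\<dots> = (expi (z' / 4) * expi (- (z / 4))) ^ 8 * expi z ^ 4 / expi z' ^ 4"
    by simp
  also have "\<dots> = expi (2 * z) / expi (2 * z')"
    by (simp add: power_mult_distrib expi_power expi_add[symmetric] expi_diff[symmetric])
  finally have "K ^ 12 * expi (2 * z') = expi (2 * z)" by simp
  moreover have "K ^ 12 = P' ^ 24 / (z ^ 12 * P ^ 24)"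
    by (simp add: K_def power_divide power_mult_distrib power_mult[symmetric])
  then have "P' ^ 24 = K ^ 12 * (z ^ 12 * P ^ 24)"
    using z0 P0 by simp
  ultimately have "P' ^ 24 * expi (2 * z') = z ^ 12 * P ^ 24 * expi (2 * z)"
    by (simp add: mult_ac)
  then show ?thesis
    by (simp add: Delta_q_def P_def P'_def z'_def mult_ac)
qed

section \<open>The generating function of tau\<close>

definition fps_map_of_int :: "int fps \<Rightarrow> 'a :: comm_ring_1 fps" where
  "fps_map_of_int f = Abs_fps (\<lambda>n. of_int (fps_nth f n))"

lemma fps_map_of_int_hom:
  "fps_map_of_int (f * g) = fps_map_of_int f * fps_map_of_int g"
  "fps_map_of_int (f - g) = fps_map_of_int f - fps_map_of_int g"
  "fps_map_of_int 1 = 1" "fps_map_of_int fps_X = fps_X"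
  by (auto simp: fps_map_of_int_def fps_eq_iff fps_mult_nth fps_X_def)

lemma fps_map_of_int_power: "fps_map_of_int (f ^ n) = fps_map_of_int f ^ n"
  by (induction n) (simp_all add: fps_map_of_int_hom)

lemma fps_map_of_int_prod: "fps_map_of_int (\<Prod>k<(n::nat). f k) = (\<Prod>k<n. fps_map_of_int (f k))"
  by (induction n) (simp_all add: fps_map_of_int_hom)

text \<open>In this form the coefficients of the infinite product can be reduced to any coefficient ring;
complex numbers and the field with two elements are the two that matter.\<close>

lemma ramanujan_tau_eventually:
  "eventually (\<lambda>N. fps_nth (fps_X * (\<Prod>k<N. 1 - fps_X ^ Suc k) ^ 24) n
     = (of_int (ramanujan_tau n) :: 'a :: comm_ring_1)) sequentially"
proof -
  let ?L = "\<Prod>k. (1 - fps_X ^ Suc k) ^ 24 :: int fps"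
  have "(\<lambda>N. \<Prod>k<N. (1 - fps_X ^ Suc k) ^ 24 :: int fps) \<longlonglongrightarrow> ?L"
    by (rule has_prod_imp_tendsto'[OF ramanujan_tau_product_converges])
  then have "eventually (\<lambda>N. fps_nth (\<Prod>k<N. (1 - fps_X ^ Suc k) ^ 24 :: int fps) (n - 1) = fps_nth ?L (n - 1)) sequentially"
    unfolding tendsto_fps_iff by blast
  then show ?thesis
  proof eventually_elim
    case (elim N)
    have "fps_X * (\<Prod>k<N. 1 - fps_X ^ Suc k) ^ 24 =
        (fps_map_of_int (fps_X * (\<Prod>k<N. (1 - fps_X ^ Suc k) ^ 24 :: int fps)) :: 'a fps)"
      by (simp only: fps_map_of_int_hom fps_map_of_int_prod fps_map_of_int_power prod_power_distrib)
    also have "fps_nth \<dots> n = of_int (fps_nth (fps_X * ?L) n)"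
      using elim by (auto simp: fps_map_of_int_def)
    finally show ?case by (simp add: ramanujan_tau_def)
  qed
qed

lemma Delta_q_holomorphic: "Delta_q holomorphic_on ball 0 1"
  unfolding Delta_q_def[abs_def] by (intro holomorphic_intros euler_prod_q_holomorphic)

text \<open>The partial products converge to the same limit both as formal power series and locally uniformly.\<close>

lemma ramanujan_tau_sums:
  assumes "norm q < 1"
  shows "(\<lambda>n. of_int (ramanujan_tau n) * q ^ n) sums Delta_q q"
proof -
  define F :: "complex fps" where "F = Abs_fps (\<lambda>n. of_int (ramanujan_tau n))"
  define P where "P N q = q * (\<Prod>k<N. 1 - q ^ Suc k) ^ 24" for N and q :: complex
  have "(\<lambda>N. fps_X * (\<Prod>k<N. 1 - fps_X ^ Suc k) ^ 24) \<longlonglongrightarrow> F"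
    unfolding tendsto_fps_iff F_def fps_nth_Abs_fps using ramanujan_tau_eventually by blast
  moreover have "uniform_limit (ball 0 (1 / 2)) P Delta_q sequentially"
  proof -
    have *: "uniform_limit (cball 0 (1 / 2)) (\<lambda>N q. (\<Prod>k<N. 1 - q ^ Suc k) ^ m) (\<lambda>q. euler_prod q 1 ^ m) sequentially"
      and bdd: "bounded ((\<lambda>q. euler_prod q 1 ^ m) ` cball 0 (1 / 2))" for m
    proof -
      have "continuous_on (cball 0 (1 / 2)) (\<lambda>q. euler_prod q 1 ^ k)" for k
        by (intro continuous_intros continuous_on_subset[OF holomorphic_on_imp_continuous_on[OF euler_prod_q_holomorphic]]) auto
      then have b: "bounded ((\<lambda>q. euler_prod q 1 ^ k) ` cball 0 (1 / 2))" for k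
        by (intro compact_imp_bounded compact_continuous_image) auto
      then show "bounded ((\<lambda>q. euler_prod q 1 ^ m) ` cball 0 (1 / 2))" .
      show "uniform_limit (cball 0 (1 / 2)) (\<lambda>N q. (\<Prod>k<N. 1 - q ^ Suc k) ^ m) (\<lambda>q. euler_prod q 1 ^ m) sequentially"
      proof (induction m)
        case (Suc m)
        show ?case
          unfolding power_Suc[where n = m]
          by (rule uniform_lim_mult[OF euler_prod_q_uniform_limit Suc.IH]) (use b[of 1] b[of m] in auto)
      qed (simp add: uniform_limit_const)
    qed
    have "uniform_limit (cball 0 (1 / 2)) P Delta_q sequentially"
      unfolding P_def Delta_q_def
      by (rule uniform_lim_mult[OF uniform_limit_const *]) (use bdd in auto)
    then show ?thesis by (rule uniform_limit_on_subset) auto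
  qed
  moreover have "P N has_fps_expansion fps_X * (\<Prod>k<N. 1 - fps_X ^ Suc k) ^ 24" for N
    unfolding P_def by (intro fps_expansion_intros)
  moreover have "P N holomorphic_on ball 0 (1 / 2)" for N
    unfolding P_def by (intro holomorphic_intros)
  moreover have exp: "Delta_q has_fps_expansion fps_expansion Delta_q 0"
    by (rule has_fps_expansion_fps_expansion[OF _ _ Delta_q_holomorphic]) auto
  ultimately have "fps_expansion Delta_q 0 = F"
    by (intro uniform_limit_imp_fps_expansion_eq[where f' = P]) auto
  then have "Delta_q has_fps_expansion F" using exp by simp
  from has_fps_expansion_imp_sums_complex[OF this, of 1 q] show ?thesis
    using Delta_q_holomorphic assms by (simp add: F_def one_ereal_def)
qed

section \<open>Tau modulo 2\<close>

text \<open>Shanks' finite form of Gauss's identity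
\<open>\<Sum>X ^ (s (s + 1) / 2) = \<Prod>(1 - X ^ (2 j)) / (1 - X ^ (2 j - 1))\<close>: the summand \<open>s = 0\<close> on the left is the
partial product, and all others are divisible by \<open>X ^ (2 n + 1)\<close>. When \<open>n\<close> grows by one, the left-hand
side changes by a telescoping sum.\<close>

lemma shanks_triangular_sum:
  fixes X :: "'a :: field fps"
  defines "X \<equiv> fps_X"
  defines "R \<equiv> \<lambda>s n. \<Prod>j\<in>{s..<n}. (1 - X ^ (2 * j + 2)) * inverse (1 - X ^ (2 * j + 1))"
  shows "(\<Sum>s\<le>n. R s n * X ^ (s * (2 * n + 1))) = (\<Sum>s\<le>2 * n. X ^ (s * (s + 1) div 2))"
proof (induction n)
  case 0
  then show ?case by (simp add: R_def)
next
  case (Suc m)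
  have inv: "inverse (1 - X ^ (2 * j + 1)) * (1 - X ^ (2 * j + 1)) = 1" for j
    by (rule inverse_mult_eq_1) (simp add: X_def)
  define D where "D = 1 - X ^ (2 * m + 1)"
  have D0: "D \<noteq> 0"
    using inv[of m] by (auto simp: D_def)
  \<comment> \<open>with \<open>v s = w (Suc s)\<close>, the increment is the telescoping sum of \<open>v s - w s\<close>\<close>
  define v where "v s = R s m * X ^ ((s + 1) * (2 * m + 1)) * (1 - X ^ (2 * s + 1))" for s
  define w where "w s = R s m * X ^ (s * (2 * m + 1)) * (1 - X ^ (2 * s))" for s
  have vw: "w (Suc s) = v s" if "s < m" for s
  proof -
    have "R s m = (1 - X ^ (2 * s + 2)) * inverse (1 - X ^ (2 * s + 1)) * R (Suc s) m"
      unfolding R_def using that by (rule prod.atLeast_Suc_lessThan)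
    then have "v s = (inverse (1 - X ^ (2 * s + 1)) * (1 - X ^ (2 * s + 1))) * w (Suc s)"
      by (simp add: v_def w_def mult_ac)
    then show ?thesis by (simp only: inv mult_1_left)
  qed
  have tele: "(\<Sum>s\<le>k. v s - w s) = v k" if "k \<le> m" for k
    using that
  proof (induction k)
    case 0
    then show ?case by (simp add: w_def)
  next
    case (Suc k)
    then show ?case using vw[of k] by simp
  qed
  have bracket: "v s - w s = R s m * ((1 - X ^ (2 * m + 2)) * X ^ (s * (2 * m + 3)) - D * X ^ (s * (2 * m + 1)))" for s
  proof -
    have 1: "X ^ (s * (2 * m + 3)) = X ^ (s * (2 * m + 1)) * X ^ (2 * s)"
      "X ^ ((s + 1) * (2 * m + 1)) = X ^ (s * (2 * m + 1)) * X ^ (2 * m + 1)"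
      by (simp_all add: power_add[symmetric] algebra_simps)
    have 2: "X ^ (2 * m + 1) * X ^ (2 * s + 1) = X ^ (2 * m + 2) * X ^ (2 * s)"
      by (simp add: power_add[symmetric] algebra_simps)
    have "X ^ (2 * m + 1) * (1 - X ^ (2 * s + 1)) - (1 - X ^ (2 * s)) =
        (1 - X ^ (2 * m + 2)) * X ^ (2 * s) - D"
      unfolding D_def right_diff_distrib left_diff_distrib 2 by simp
    then have "R s m * X ^ (s * (2 * m + 1)) * (X ^ (2 * m + 1) * (1 - X ^ (2 * s + 1)) - (1 - X ^ (2 * s))) =
        R s m * X ^ (s * (2 * m + 1)) * ((1 - X ^ (2 * m + 2)) * X ^ (2 * s) - D)" by simp
    then show ?thesis unfolding v_def w_def 1 by (simp add: algebra_simps)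
  qed
  have DR: "D * R s (Suc m) = R s m * (1 - X ^ (2 * m + 2))" if "s \<le> m" for s
  proof -
    have "R s (Suc m) = R s m * ((1 - X ^ (2 * m + 2)) * inverse D)"
      unfolding R_def D_def using that by (rule prod.atLeastLessThan_Suc)
    then have "D * R s (Suc m) = R s m * (1 - X ^ (2 * m + 2)) * (inverse D * D)"
      by (simp only: mult_ac)
    also have "inverse D * D = 1" unfolding D_def by (rule inv)
    finally show ?thesis by simp
  qed
  have "D * (\<Sum>s\<le>m. R s (Suc m) * X ^ (s * (2 * Suc m + 1))) - D * (\<Sum>s\<le>m. R s m * X ^ (s * (2 * m + 1)))
      = (\<Sum>s\<le>m. v s - w s)"
    unfolding bracket sum_distrib_left sum_subtractf[symmetric]
  proof (intro sum.cong refl)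
    fix s assume "s \<in> {..m}"
    then have DR': "D * R s (Suc m) = R s m * (1 - X ^ (2 * m + 2))" by (intro DR) simp
    have e: "s * (2 * Suc m + 1) = s * (2 * m + 3)" by (simp add: algebra_simps)
    show "D * (R s (Suc m) * X ^ (s * (2 * Suc m + 1))) - D * (R s m * X ^ (s * (2 * m + 1))) =
        R s m * ((1 - X ^ (2 * m + 2)) * X ^ (s * (2 * m + 3)) - D * X ^ (s * (2 * m + 1)))"
      unfolding e mult.assoc[symmetric] DR' right_diff_distrib by (simp only: mult_ac)
  qed
  also have "\<dots> = D * X ^ ((m + 1) * (2 * m + 1))"
    unfolding tele[OF order_refl] by (simp add: v_def R_def D_def mult_ac)
  finally have "D * ((\<Sum>s\<le>m. R s (Suc m) * X ^ (s * (2 * Suc m + 1))) - (\<Sum>s\<le>m. R s m * X ^ (s * (2 * m + 1))) - X ^ ((m + 1) * (2 * m + 1))) = 0"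
    by (simp only: right_diff_distrib) simp
  then have "(\<Sum>s\<le>m. R s (Suc m) * X ^ (s * (2 * Suc m + 1))) = (\<Sum>s\<le>m. R s m * X ^ (s * (2 * m + 1))) + X ^ ((m + 1) * (2 * m + 1))"
    using D0 by (simp only: mult_eq_0_iff simp_thms diff_diff_eq right_minus_eq)
  moreover have "R (Suc m) (Suc m) = 1" by (simp add: R_def)
  moreover have "(m + 1) * (2 * m + 1) = (2 * m + 1) * (2 * m + 1 + 1) div 2"
    "Suc m * (2 * Suc m + 1) = (2 * m + 2) * (2 * m + 2 + 1) div 2"
    by (simp_all add: algebra_simps)
  moreover have "2 * Suc m = Suc (Suc (2 * m))" by simp
  ultimately show ?case using Suc.IH by (simp del: power_Suc mult_Suc mult_Suc_right)
qed

text \<open>The Frobenius map: the products \<open>f i * f (n - i)\<close> and \<open>f (n - i) * f i\<close> cancel, so only a middle term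
remains.\<close>

lemma fps_bit_square_nth:
  fixes f :: "bit fps"
  shows "fps_nth (f\<^sup>2) n = (if even n then fps_nth f (n div 2) else 0)"
proof -
  define g where "g i = fps_nth f i * fps_nth f (n - i)" for i
  have "fps_nth (f\<^sup>2) n = sum g {0..n}"
    by (simp add: power2_eq_square fps_mult_nth g_def)
  also have "{0..n} = {i. 2 * i < n} \<union> {i. 2 * i = n} \<union> {i. i \<le> n \<and> n < 2 * i}" by auto
  also have "sum g \<dots> = sum g {i. 2 * i < n} + sum g {i. 2 * i = n} + sum g {i. i \<le> n \<and> n < 2 * i}"
  proof -
    have fin: "finite {i. 2 * i < n}" "finite {i. 2 * i = n}" "finite {i. i \<le> n \<and> n < 2 * i}"
      by (auto intro: finite_subset[of _ "{..n}"])
    show ?thesis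
      using fin by (subst sum.union_disjoint; (subst sum.union_disjoint)?) auto
  qed
  also have "sum g {i. i \<le> n \<and> n < 2 * i} = sum g {i. 2 * i < n}"
    by (rule sum.reindex_bij_witness[of _ "\<lambda>i. n - i" "\<lambda>i. n - i"]) (auto simp: g_def)
  also have "{i. 2 * i = n} = (if even n then {n div 2} else {})" by auto
  also have "sum g {i. 2 * i < n} + sum g (if even n then {n div 2} else {}) + sum g {i. 2 * i < n} =
      sum g (if even n then {n div 2} else {})"
    by (cases "sum g {i. 2 * i < n}") simp_all
  finally show ?thesis
    by (cases "fps_nth f (n div 2)") (auto simp: g_def)
qed

text \<open>In characteristic 2 one has \<open>1 - X ^ (2 j) = (1 - X ^ j)\<^sup>2\<close>, and this turns the product in Gauss's
identity into the cube of Euler's product.\<close>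

lemma gauss_triangular_mod_2:
  defines "E \<equiv> \<lambda>n. \<Prod>k<n. 1 - fps_X ^ Suc k :: bit fps"
  assumes k: "k \<le> n"
  shows "fps_nth (E n ^ 3) k = fps_nth (\<Sum>s\<le>2 * n. fps_X ^ (s * (s + 1) div 2)) k"
proof -
  define X :: "bit fps" where "X = fps_X"
  define R where "R = (\<lambda>s n. \<Prod>j\<in>{s..<n}. (1 - X ^ (2 * j + 2)) * inverse (1 - X ^ (2 * j + 1)))"
  define odds where "odds n = (\<Prod>j<n. 1 - X ^ (2 * j + 1))" for n
  have two: "(2 :: bit fps) = 0"
    by (simp add: fps_eq_iff numeral_fps_const)
  have inv: "inverse (1 - X ^ (2 * j + 1)) * (1 - X ^ (2 * j + 1)) = 1" for j
    by (rule inverse_mult_eq_1) (simp add: X_def)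
  have sq: "(1 - a)\<^sup>2 = 1 - a\<^sup>2" for a :: "bit fps"
  proof -
    have "(1 - a)\<^sup>2 = 1 - a\<^sup>2 + 2 * (a\<^sup>2 - a)" by (simp add: power2_eq_square algebra_simps)
    then show ?thesis by (simp add: two)
  qed
  have evens: "(\<Prod>j<n. 1 - X ^ (2 * j + 2)) = (E n)\<^sup>2" for n
  proof -
    have "(X ^ Suc j)\<^sup>2 = X ^ (2 * j + 2)" for j
      by (subst power_mult[symmetric], rule arg_cong[of _ _ "(^) X"]) simp
    then show ?thesis
      unfolding E_def prod_power_distrib X_def[symmetric] sq by simp
  qed
  have "R 0 n * odds n = (\<Prod>j<n. 1 - X ^ (2 * j + 2))" 
    unfolding R_def odds_def atLeast0LessThan prod.distrib[symmetric] mult.assoc inv by simp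
  then have R: "R 0 n * odds n = (E n)\<^sup>2" by (simp only: evens)
  have "E (2 * n) = odds n * (\<Prod>j<n. 1 - X ^ (2 * j + 2))" for n
    unfolding E_def odds_def by (induction n) (simp_all add: X_def mult_ac)
  then have E2n: "E (2 * n) = odds n * (E n)\<^sup>2" by (simp only: evens)
  have "\<exists>h. E (n + m) = E n * (1 + X ^ Suc n * h)" for m
  proof (induction m)
    case 0
    show ?case by (rule exI[of _ 0]) simp
  next
    case (Suc m)
    then obtain h where h: "E (n + m) = E n * (1 + X ^ Suc n * h)" by blast
    have "E (n + Suc m) = E (n + m) * (1 - X ^ Suc n * X ^ m)"
      by (simp add: E_def X_def power_add mult_ac)
    also have "\<dots> = E n * (1 + X ^ Suc n * (h - X ^ m - X ^ Suc n * h * X ^ m))"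
      unfolding h by (simp add: algebra_simps)
    finally show ?case by blast
  qed
  from this[of n] obtain h where h: "E (2 * n) = E n * (1 + X ^ Suc n * h)" 
    by (auto simp: mult_2)
  have "fps_nth (E n) 0 = 1" unfolding E_def by (induction n) simp_all
  then have E0: "E n \<noteq> 0" by auto
  have "E n * (R 0 n * (1 + X ^ Suc n * h)) = R 0 n * E (2 * n)"
    unfolding h by (simp only: mult_ac)
  also have "\<dots> = (R 0 n * odds n) * (E n)\<^sup>2"
    unfolding E2n by (simp only: mult_ac)
  also have "\<dots> = E n * E n ^ 3"
    unfolding R by (simp add: power2_eq_square power3_eq_cube mult_ac)
  finally have "E n ^ 3 = R 0 n * (1 + X ^ Suc n * h)" using E0 by simp
  also have "\<dots> = R 0 n + X ^ Suc n * (R 0 n * h)" by (simp add: algebra_simps)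
  finally have "fps_nth (E n ^ 3) k = fps_nth (R 0 n) k"
    using k by (simp add: X_def fps_X_power_mult_nth del: power_Suc)
  also have "\<dots> = fps_nth (\<Sum>s\<le>n. R s n * X ^ (s * (2 * n + 1))) k"
  proof -
    have "{..n} = insert 0 {1..n}" by auto
    then have "(\<Sum>s\<le>n. R s n * X ^ (s * (2 * n + 1))) =
        R 0 n + (\<Sum>s\<in>{1..n}. R s n * X ^ (s * (2 * n + 1)))"
      by simp
    moreover have "fps_nth (\<Sum>s\<in>{1..n}. R s n * X ^ (s * (2 * n + 1))) k = 0"
      unfolding fps_sum_nth
    proof (intro sum.neutral ballI)
      fix s assume s: "s \<in> {1..n}"
      have "k < 1 * (2 * n + 1)" using k by simp
      also have "\<dots> \<le> s * (2 * n + 1)" using s by (intro mult_le_mono1) simp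
      finally have "k < s * (2 * n + 1)" .
      then show "fps_nth (R s n * X ^ (s * (2 * n + 1))) k = 0"
        by (simp add: X_def fps_X_power_mult_right_nth)
    qed
    ultimately show ?thesis by simp
  qed
  also have "(\<Sum>s\<le>n. R s n * X ^ (s * (2 * n + 1))) = (\<Sum>s\<le>2 * n. X ^ (s * (s + 1) div 2))"
    unfolding R_def X_def by (rule shanks_triangular_sum)
  finally show ?thesis by (simp add: X_def)
qed

theorem odd_ramanujan_tau_imp_odd_square:
  assumes "odd (ramanujan_tau n)"
  shows "\<exists>s. n = (2 * s + 1)\<^sup>2"
proof -
  define E where "E = (\<lambda>n. \<Prod>k<n. 1 - fps_X ^ Suc k :: bit fps)"
  obtain N where N: "N \<ge> n" "fps_nth (fps_X * E N ^ 24) n = of_int (ramanujan_tau n)"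
    using ramanujan_tau_eventually[where 'a = bit, of n] unfolding eventually_sequentially E_def
    by (metis nle_le)
  obtain j where "ramanujan_tau n = 2 * j + 1" using assms by (elim oddE)
  then have "fps_nth (fps_X * E N ^ 24) n = 1" using N(2) by simp
  then have n: "n \<noteq> 0" "fps_nth (E N ^ 24) (n - 1) = 1" by (auto split: if_splits)
  have "E N ^ 24 = (((E N ^ 3)\<^sup>2)\<^sup>2)\<^sup>2" by (simp add: power_mult[symmetric])
  then have "fps_nth ((((E N ^ 3)\<^sup>2)\<^sup>2)\<^sup>2) (n - 1) = 1" using n by simp
  then have even: "even (n - 1)" "even ((n - 1) div 2)" "even ((n - 1) div 2 div 2)"
    and "fps_nth (E N ^ 3) ((n - 1) div 2 div 2 div 2) = 1"
    unfolding fps_bit_square_nth by (auto split: if_splits)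
  define k where "k = (n - 1) div 2 div 2 div 2"
  have "fps_nth (\<Sum>s\<le>2 * N. fps_X ^ (s * (s + 1) div 2) :: bit fps) k \<noteq> 0"
    using \<open>fps_nth (E N ^ 3) ((n - 1) div 2 div 2 div 2) = 1\<close> gauss_triangular_mod_2[of k N] N(1)
    by (simp add: E_def k_def)
  then obtain s where "fps_nth (fps_X ^ (s * (s + 1) div 2) :: bit fps) k \<noteq> 0"
    unfolding fps_sum_nth using sum.not_neutral_contains_not_neutral by blast
  then have s: "k = s * (s + 1) div 2"
    by (simp only: fps_X_power_iff fps_nth_Abs_fps split: if_splits) simp
  have "2 * (2 * (2 * k)) = n - 1"
    unfolding k_def by (simp only: dvd_mult_div_cancel[OF even(1)] dvd_mult_div_cancel[OF even(2)]
        dvd_mult_div_cancel[OF even(3)])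
  then have "n = 8 * k + 1" using n(1) by linarith
  also have "8 * k = 4 * (s * (s + 1))" 
  proof -
    have "even (s * (s + 1))" by simp
    then have "2 * k = s * (s + 1)" unfolding s by (rule dvd_mult_div_cancel)
    then show ?thesis by simp
  qed
  also have "4 * (s * (s + 1)) + 1 = (2 * s + 1)\<^sup>2" by (simp add: power2_eq_square algebra_simps)
  finally show ?thesis by blast
qed

section \<open>The modular group\<close>

definition Delta :: "complex \<Rightarrow> complex" where
  "Delta z = Delta_q (expi (2 * z))"

lemma Delta_neg_inverse: "Im z > 0 \<Longrightarrow> Delta (- 1 / z) = z ^ 12 * Delta z"
  unfolding Delta_def by (rule Delta_q_inversion)

lemma Delta_add_int: "Delta (z + of_int n) = Delta z"
proof -
  have "expi (2 * of_int n) = 1" by (simp only: expi_eq_1_iff Ints_of_int)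
  then show ?thesis by (simp only: Delta_def distrib_left expi_add mult_1_right)
qed

lemma Im_neg_inverse: "Im z > 0 \<Longrightarrow> Im (- 1 / z) > 0"
  by (simp add: Im_divide sum_power2_gt_zero_iff)

text \<open>The Euclidean algorithm on the lower row \<open>(c, d)\<close>: multiplying the matrix on the right by a translation
and the inversion replaces \<open>(c, d)\<close> by \<open>(d mod c, - c)\<close>.\<close>

lemma Delta_modular:
  fixes a b c d :: int
  assumes "a * d - b * c = 1" "Im z > 0"
  shows "Delta ((of_int a * z + of_int b) / (of_int c * z + of_int d)) = (of_int c * z + of_int d) ^ 12 * Delta z"
  using assms
proof (induction "nat \<bar>c\<bar>" arbitrary: a b c d z rule: less_induct)
  case less
  show ?case
  proof (cases "c = 0")
    case True
    then have "a * d = 1" using less.prems by simp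
    then have "a = 1 \<and> d = 1 \<or> a = -1 \<and> d = -1" by (simp add: zmult_eq_1_iff)
    then show ?thesis
      using True Delta_add_int[of z b] Delta_add_int[of z "- b"] by auto
  next
    case False
    define k where "k = - (d div c)"
    define a' b' c' d' where "a' = a * k + b" and "b' = - a" and "c' = c * k + d" and "d' = - c"
    have "c' = d mod c" by (simp add: c'_def k_def minus_mult_div_eq_mod[symmetric])
    then have "nat \<bar>c'\<bar> < nat \<bar>c\<bar>"
      using False abs_mod_less[of c d] by simp
    moreover have det: "a' * d' - b' * c' = 1"
      using less.prems(1) by (simp add: a'_def b'_def c'_def d'_def algebra_simps)
    moreover define w where "w = z - of_int k"
    define u where "u = - 1 / w"
    have w: "Im w > 0" using less.prems by (simp add: w_def)
    then have u: "Im u > 0" unfolding u_def by (rule Im_neg_inverse)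
    ultimately have "Delta ((of_int a' * u + of_int b') / (of_int c' * u + of_int d')) =
        (of_int c' * u + of_int d') ^ 12 * Delta u"
      using less.hyps by blast
    also have "Delta u = w ^ 12 * Delta w" unfolding u_def by (rule Delta_neg_inverse[OF w])
    also have "Delta w = Delta z"
      using Delta_add_int[of z "- k"] by (simp add: w_def)
    finally have main: "Delta ((of_int a' * u + of_int b') / (of_int c' * u + of_int d')) =
        ((of_int c' * u + of_int d') * w) ^ 12 * Delta z"
      by (simp add: power_mult_distrib)
    have w0: "w \<noteq> 0" using w by auto
    have cu: "(of_int c' * u + of_int d') * w = - (of_int c * z + of_int d)"
      using w0 by (simp add: u_def c'_def d'_def field_simps) (simp add: w_def algebra_simps)
    have au: "(of_int a' * u + of_int b') * w = - (of_int a * z + of_int b)"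
      using w0 by (simp add: u_def a'_def b'_def field_simps) (simp add: w_def algebra_simps)
    have "(of_int a' * u + of_int b') / (of_int c' * u + of_int d') =
        ((of_int a' * u + of_int b') * w) / ((of_int c' * u + of_int d') * w)"
      using w0 by simp
    also have "\<dots> = (of_int a * z + of_int b) / (of_int c * z + of_int d)"
      unfolding cu au by (rule minus_divide_divide)
    finally show ?thesis using main unfolding cu by (simp only: power_minus_Bit0)
  qed
qed

text \<open>Choosing the real part in \<open>[- 1/2, 1/2]\<close> matters: if moreover \<open>Im z = 1/2\<close>, then inversion increases
the imaginary part.\<close>

lemma nome_exists:
  assumes "q \<noteq> 0" "norm q < 1"
  obtains z where "Im z > 0" "expi (2 * z) = q" "\<bar>Re z\<bar> \<le> 1 / 2" "norm q = exp (- 2 * pi * Im z)"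
proof
  define z where "z = Ln q / (2 * of_real pi * \<i>)"
  show e: "expi (2 * z) = q" using assms(1) by (simp add: expi_def z_def)
  show n: "norm q = exp (- 2 * pi * Im z)"
    using norm_expi[of "2 * z"] unfolding e by simp
  then show "Im z > 0" using assms(2) by (simp add: zero_less_mult_iff)
  have "Re z = Im (Ln q) / (2 * pi)" by (simp add: z_def Re_divide power2_eq_square)
  then have "\<bar>Re z\<bar> = \<bar>Im (Ln q)\<bar> / (2 * pi)" by (simp add: abs_mult)
  also have "\<dots> \<le> pi / (2 * pi)"
    using mpi_less_Im_Ln[OF assms(1)] Im_Ln_le_pi[OF assms(1)] by (intro divide_right_mono) auto
  finally show "\<bar>Re z\<bar> \<le> 1 / 2" by simp
qed

definition hecke :: "nat \<Rightarrow> complex \<Rightarrow> complex" where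
  "hecke p z = of_nat p ^ 11 * Delta (of_nat p * z) + (\<Sum>b<p. Delta ((z + of_nat b) / of_nat p)) / of_nat p"

section \<open>The Hecke operator\<close>

text \<open>This involution describes how inversion permutes the summands of the Hecke operator.\<close>

lemma neg_inverse_mod_prime:
  assumes "prime p"
  obtains s :: "nat \<Rightarrow> nat" where "\<And>b. b \<in> {1..<p} \<Longrightarrow> s b \<in> {1..<p}" "\<And>b. b \<in> {1..<p} \<Longrightarrow> s (s b) = b"
    "\<And>b. b \<in> {1..<p} \<Longrightarrow> p dvd b * s b + 1"
proof -
  have "\<exists>c. c \<in> {1..<p} \<and> p dvd b * c + 1" if b: "b \<in> {1..<p}" for b
  proof -
    have "\<not> p dvd b" using b by (auto dest: dvd_imp_le)
    then have "coprime (int b) (int p)"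
      using assms prime_imp_coprime_nat[of p b] by (simp add: coprime_commute)
    then obtain x where "[int b * x = 1] (mod int p)" using cong_solve_coprime_int by blast
    then have x: "int p dvd int b * x - 1" by (simp add: cong_iff_dvd_diff)
    define c where "c = nat ((- x) mod int p)"
    have p: "p > 1" using assms prime_gt_1_nat by blast
    have c: "int c = (- x) mod int p" using p by (simp add: c_def)
    have "int p dvd (- x) - int c" unfolding c by (simp add: dvd_minus_mod)
    then have "int p dvd int b * ((- x) - int c)" by (rule dvd_mult)
    with x have "int p dvd - ((int b * x - 1) + int b * ((- x) - int c))" by (simp only: dvd_minus_iff dvd_add)
    then have "int p dvd int (b * c + 1)" by (simp add: algebra_simps)
    then have dvd: "p dvd b * c + 1" by (simp only: int_dvd_int_iff)
    have "c \<noteq> 0"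
    proof
      assume "c = 0"
      then show False using dvd p by simp
    qed
    moreover have "int c < int p" unfolding c using p by simp
    ultimately have "c \<in> {1..<p}" by simp
    then show ?thesis using dvd by blast
  qed
  then obtain s where s: "\<And>b. b \<in> {1..<p} \<Longrightarrow> s b \<in> {1..<p} \<and> p dvd b * s b + 1" by metis
  have "s (s b) = b" if b: "b \<in> {1..<p}" for b
  proof -
    have 1: "int p dvd int (b * s b + 1)" "int p dvd int (s b * s (s b) + 1)" "s b \<in> {1..<p}" "s (s b) \<in> {1..<p}"
      using s[OF b] s[of "s b"] by (simp_all only: int_dvd_int_iff)
    then have "int p dvd int (b * s b + 1) - int (s b * s (s b) + 1)" by (intro dvd_diff)
    then have "int p dvd int (s b) * (int b - int (s (s b)))" by (simp add: algebra_simps)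
    moreover have "prime (int p)" using assms by simp
    moreover have "\<not> int p dvd int (s b)" using 1(3) by (auto dest!: dvd_imp_le simp: int_dvd_int_iff)
    ultimately have "int p dvd int b - int (s (s b))" by (metis prime_dvd_mult_iff)
    moreover have "\<bar>int b - int (s (s b))\<bar> < int p" using 1(4) b by auto
    ultimately show ?thesis using zdvd_imp_le[of "int p" "\<bar>int b - int (s (s b))\<bar>"] by fastforce
  qed
  then show ?thesis using that s by blast
qed

text \<open>The term \<open>\<Delta>(p z)\<close> is exchanged with the summand for \<open>b = 0\<close>; a summand for \<open>b \<noteq> 0\<close> goes to the one
for the negative inverse of \<open>b\<close> modulo \<open>p\<close>, by a matrix of determinant \<open>1\<close>.\<close>

lemma hecke_neg_inverse:
  assumes p: "prime p" and z: "Im z > 0"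
  shows "hecke p (- 1 / z) = z ^ 12 * hecke p z"
proof -
  obtain s where s: "\<And>b. b \<in> {1..<p} \<Longrightarrow> s b \<in> {1..<p}" "\<And>b. b \<in> {1..<p} \<Longrightarrow> s (s b) = b"
    "\<And>b. b \<in> {1..<p} \<Longrightarrow> p dvd b * s b + 1"
    using neg_inverse_mod_prime[OF p] by blast
  define P :: complex where "P = of_nat p"
  have p0: "p > 0" using p prime_gt_0_nat by blast
  then have P0: "P \<noteq> 0" by (simp add: P_def)
  have z0: "z \<noteq> 0" using z by auto
  have zP: "Im (z / P) > 0" "Im (P * z) > 0" using z p0 by (simp_all add: P_def)
  have split: "{..<p} = insert 0 {1..<p}" using p0 by auto
  have sum_split: "(\<Sum>b<p. f b) = f 0 + (\<Sum>b\<in>{1..<p}. f b)" for f :: "nat \<Rightarrow> complex"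
    unfolding split by simp
  have P12: "P ^ 12 = P * P ^ 11" by (simp flip: power_Suc)
  have "Delta (P * (- 1 / z)) = (z / P) ^ 12 * Delta (z / P)"
    using Delta_neg_inverse[OF zP(1)] z0 P0 by simp
  then have 1: "P ^ 11 * Delta (P * (- 1 / z)) = z ^ 12 * (Delta (z / P) / P)"
    using P0 by (simp add: power_divide P12)
  have "Delta ((- 1 / z) / P) = (P * z) ^ 12 * Delta (P * z)"
    using Delta_neg_inverse[OF zP(2)] by (simp add: mult.commute)
  then have 2: "Delta ((- 1 / z) / P) / P = z ^ 12 * (P ^ 11 * Delta (P * z))"
    using P0 by (simp add: power_mult_distrib P12)
  have 3: "(\<Sum>b\<in>{1..<p}. Delta ((- 1 / z + of_nat b) / P)) = z ^ 12 * (\<Sum>b\<in>{1..<p}. Delta ((z + of_nat b) / P))"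
    unfolding sum_distrib_left
  proof (rule sum.reindex_bij_witness[of _ s s])
    fix b assume b: "b \<in> {1..<p}"
    show "s (s b) = b" "s b \<in> {1..<p}" using s b by auto
    show "s (s b) = b" "s b \<in> {1..<p}" using s b by auto
    obtain k where k: "b * s b + 1 = p * k" using s(3)[OF b] by (elim dvdE)
    define w where "w = (z + of_nat (s b)) / P"
    have w: "Im w > 0" using z p0 by (simp add: w_def P_def)
    have det: "int b * (- int (s b)) - (- int k) * int p = 1"
    proof -
      have "int b * int (s b) + 1 = int p * int k" using arg_cong[OF k, of int] by simp
      then show ?thesis by (simp add: mult.commute)
    qed
    have den: "of_int (int p) * w + of_int (- int (s b)) = z"
      using P0 by (simp add: w_def P_def)
    have num: "of_int (int b) * w + of_int (- int k) = (of_nat b * z - 1) / P"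
    proof -
      have "of_nat b * of_nat (s b) + 1 = P * of_nat k"
        using arg_cong[OF k, of "of_nat :: nat \<Rightarrow> complex"] by (simp add: P_def add.commute)
      then have "of_nat b * (z + of_nat (s b)) - P * of_nat k = of_nat b * z - 1"
        by (simp add: algebra_simps)
      then show ?thesis using P0 by (simp add: w_def field_simps)
    qed
    have "Delta (((of_nat b * z - 1) / P) / z) = z ^ 12 * Delta w"
      using Delta_modular[OF det w] unfolding den num .
    moreover have "((of_nat b * z - 1) / P) / z = (- 1 / z + of_nat b) / P"
      using z0 P0 by (simp add: field_simps)
    ultimately show "z ^ 12 * Delta ((z + of_nat (s b)) / P) = Delta ((- 1 / z + of_nat b) / P)"
      by (simp add: w_def)
  qed
  have "hecke p (- 1 / z) = P ^ 11 * Delta (P * (- 1 / z)) + Delta ((- 1 / z) / P) / P +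
      (\<Sum>b\<in>{1..<p}. Delta ((- 1 / z + of_nat b) / P)) / P"
    unfolding hecke_def sum_split P_def[symmetric] by (simp add: add_divide_distrib)
  also have "\<dots> = z ^ 12 * (P ^ 11 * Delta (P * z) + Delta (z / P) / P + (\<Sum>b\<in>{1..<p}. Delta ((z + of_nat b) / P)) / P)"
    unfolding 1 2 3 by (simp add: algebra_simps)
  also have "\<dots> = z ^ 12 * hecke p z"
    unfolding hecke_def sum_split P_def[symmetric] by (simp add: add_divide_distrib)
  finally show ?thesis .
qed

text \<open>Averaging over the translations by \<open>b / p\<close> retains exactly the exponents divisible by \<open>p\<close>.\<close>

lemma hecke_sums:
  assumes p: "prime p" and z: "Im z > 0"
  shows "(\<lambda>n. of_int (ramanujan_tau (p * n) + int p ^ 11 * (if p dvd n then ramanujan_tau (n div p) else 0))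
     * expi (2 * z) ^ n) sums hecke p z"
proof -
  define P :: complex where "P = of_nat p"
  define q where "q = expi (2 * z)"
  define r where "r = expi (2 * (z / P))"
  define \<omega> where "\<omega> = expi (2 * (1 / P))"
  have p0: "p > 0" using p prime_gt_0_nat by blast
  then have P0: "P \<noteq> 0" by (simp add: P_def)
  have Delta_sums: "(\<lambda>n. of_int (ramanujan_tau n) * expi (2 * w) ^ n) sums Delta w" if "Im w > 0" for w
    unfolding Delta_def by (rule ramanujan_tau_sums[OF norm_nome_less_1[OF that]])
  have mono: "strict_mono (\<lambda>n. p * n)" using p0 by (simp add: strict_mono_def)
  have range: "n \<notin> range (\<lambda>n. p * n) \<longleftrightarrow> \<not> p dvd n" for n by auto
  have rq: "r ^ (p * n) = q ^ n" for n
    unfolding power_mult r_def q_def expi_power using P0 by (simp add: P_def)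
  have 1: "(\<lambda>n. of_int (int p ^ 11 * (if p dvd n then ramanujan_tau (n div p) else 0)) * q ^ n)
      sums (P ^ 11 * Delta (P * z))"
  proof -
    have "Im (P * z) > 0" using z p0 by (simp add: P_def)
    then have "(\<lambda>n. of_int (ramanujan_tau n) * expi (2 * (P * z)) ^ n) sums Delta (P * z)"
      by (rule Delta_sums)
    moreover have "expi (2 * (P * z)) = q ^ p"
      unfolding q_def expi_power by (simp add: P_def mult_ac)
    ultimately have "(\<lambda>n. P ^ 11 * (of_int (ramanujan_tau n) * q ^ (p * n))) sums (P ^ 11 * Delta (P * z))"
      by (intro sums_mult) (simp add: power_mult)
    also have "(\<lambda>n. P ^ 11 * (of_int (ramanujan_tau n) * q ^ (p * n))) =
        (\<lambda>n. of_int (int p ^ 11 * (if p dvd p * n then ramanujan_tau (p * n div p) else 0)) * q ^ (p * n))"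
      using p0 by (auto simp: P_def)
    finally show ?thesis
      by (subst (asm) sums_mono_reindex[OF mono]) (auto simp: range)
  qed
  \<comment> \<open>\<open>\<omega>\<close> is a primitive \<open>p\<close>-th root of unity\<close>
  have root: "(\<Sum>b<p. (\<omega> ^ n) ^ b) = (if p dvd n then P else 0)" for n
  proof -
    have "\<omega> ^ n = expi (2 * (of_nat n / P))" unfolding \<omega>_def expi_power by (simp add: mult_ac)
    then have "\<omega> ^ n = 1 \<longleftrightarrow> (of_nat n / of_nat p :: complex) \<in> \<int>" by (simp only: expi_eq_1_iff P_def)
    also have "\<dots> \<longleftrightarrow> p dvd n"
    proof
      assume "of_nat n / of_nat p \<in> (\<int> :: complex set)"
      then obtain j where "of_nat n / of_nat p = (of_int j :: complex)" by (elim Ints_cases)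
      then have "of_int (int n) = (of_int (int p * j) :: complex)" using p0 by (simp add: field_simps)
      then have "int n = int p * j" by (simp only: of_int_eq_iff)
      then show "p dvd n" by (metis dvd_triv_left int_dvd_int_iff)
    qed (use p0 in \<open>auto elim!: dvdE\<close>)
    finally have one: "\<omega> ^ n = 1 \<longleftrightarrow> p dvd n" .
    have "(\<omega> ^ n) ^ p = expi (2 * of_nat n)"
      unfolding \<omega>_def expi_power using P0 by (simp add: P_def mult_ac)
    also have "\<dots> = 1" by (simp only: expi_eq_1_iff Ints_of_nat)
    finally show ?thesis using one by (auto simp: sum_gp_strict P_def)
  qed
  have 2: "(\<lambda>n. of_int (ramanujan_tau (p * n)) * q ^ n) sums ((\<Sum>b<p. Delta ((z + of_nat b) / P)) / P)"
  proof -
    have "(\<lambda>n. of_int (ramanujan_tau n) * r ^ n * (\<omega> ^ n) ^ b) sums Delta ((z + of_nat b) / P)" for b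
    proof -
      have "Im ((z + of_nat b) / P) > 0" using z p0 by (simp add: P_def)
      from Delta_sums[OF this]
      have "(\<lambda>n. of_int (ramanujan_tau n) * expi (2 * ((z + of_nat b) / P)) ^ n) sums Delta ((z + of_nat b) / P)" .
      also have "expi (2 * ((z + of_nat b) / P)) = r * \<omega> ^ b"
        unfolding r_def \<omega>_def expi_power expi_add[symmetric]
        by (simp add: add_divide_distrib algebra_simps)
      finally show ?thesis by (simp add: power_mult_distrib mult.assoc flip: power_mult) (simp add: mult.commute)
    qed
    then have "(\<lambda>n. \<Sum>b<p. of_int (ramanujan_tau n) * r ^ n * (\<omega> ^ n) ^ b) sums (\<Sum>b<p. Delta ((z + of_nat b) / P))"
      by (intro sums_sum)
    then have "(\<lambda>n. of_int (ramanujan_tau n) * r ^ n * (if p dvd n then P else 0)) sums (\<Sum>b<p. Delta ((z + of_nat b) / P))"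
      by (simp only: sum_distrib_left[symmetric] root)
    then have "(\<lambda>n. of_int (ramanujan_tau n) * r ^ n * (if p dvd n then P else 0) / P) sums ((\<Sum>b<p. Delta ((z + of_nat b) / P)) / P)"
      by (rule sums_divide)
    then have "(\<lambda>n. of_int (ramanujan_tau (p * n)) * r ^ (p * n) * (if p dvd p * n then P else 0) / P) sums ((\<Sum>b<p. Delta ((z + of_nat b) / P)) / P)"
      by (subst sums_mono_reindex[OF mono]) (auto simp: range)
    then show ?thesis using P0 by (simp add: rq)
  qed
  show ?thesis
    using sums_add[OF 2 1] unfolding hecke_def P_def[symmetric] q_def[symmetric]
    by (simp add: algebra_simps)
qed

lemma ramanujan_tau_0: "ramanujan_tau 0 = 0"
  by (simp add: ramanujan_tau_def)

lemma ramanujan_tau_1: "ramanujan_tau 1 = 1"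
proof -
  obtain N where "fps_nth (fps_X * (\<Prod>k<N. 1 - fps_X ^ Suc k) ^ 24) 1 = ramanujan_tau 1"
    using eventually_happens[OF ramanujan_tau_eventually[where 'a = int, of 1]] by auto
  moreover have "fps_nth (\<Prod>k<N. 1 - fps_X ^ Suc k :: int fps) 0 = 1"
    by (induction N) simp_all
  ultimately show ?thesis by (simp add: fps_nth_power_0)
qed

text \<open>Let \<open>H\<close> be \<open>(T\<^sub>p \<Delta> - \<tau>(p) \<Delta>) / \<Delta>\<close> as a function of the nome \<open>q\<close>. The power series in the numerator
starts with \<open>q\<^sup>2\<close> and \<open>\<Delta>\<close> has no zeros and starts with \<open>q\<close>, so \<open>H\<close> is holomorphic in the unit disc and
vanishes at \<open>0\<close>. It is invariant under inversion. A maximum of \<open>\<bar>H\<bar>\<close> on the disc \<open>\<bar>q\<bar> \<le> exp(- \<pi>)\<close>,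
which corresponds to \<open>Im z \<ge> 1/2\<close>, can be moved by inversion from the boundary into the interior, so
the maximum modulus principle gives \<open>H = 0\<close>.\<close>

theorem ramanujan_tau_hecke:
  assumes p: "prime p"
  shows "ramanujan_tau p * ramanujan_tau n =
    ramanujan_tau (p * n) + int p ^ 11 * (if p dvd n then ramanujan_tau (n div p) else 0)"
proof -
  define c where "c n = ramanujan_tau (p * n) + int p ^ 11 * (if p dvd n then ramanujan_tau (n div p) else 0)
    - ramanujan_tau p * ramanujan_tau n" for n
  have p1: "p > 1" using p prime_gt_1_nat by blast
  have c01: "c 0 = 0" "c 1 = 0"
    using p1 by (simp_all add: c_def ramanujan_tau_0 ramanujan_tau_1[unfolded One_nat_def])
  define t :: complex where "t = of_int (ramanujan_tau p)"
  have c_sums: "(\<lambda>n. of_int (c n) * expi (2 * z) ^ n) sums (hecke p z - t * Delta z)" if "Im z > 0" for z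
  proof -
    have "(\<lambda>n. t * (of_int (ramanujan_tau n) * expi (2 * z) ^ n)) sums (t * Delta z)"
      unfolding Delta_def by (intro sums_mult ramanujan_tau_sums norm_nome_less_1 that)
    from sums_diff[OF hecke_sums[OF p that] this] show ?thesis
      by (simp add: c_def t_def algebra_simps)
  qed
  define F :: "complex fps" where "F = Abs_fps (\<lambda>n. of_int (c (Suc (Suc n))))"
  have F_sums: "(\<lambda>n. fps_nth F n * expi (2 * z) ^ n) sums ((hecke p z - t * Delta z) / expi (2 * z) ^ 2)" if "Im z > 0" for z
  proof -
    have "(\<lambda>n. of_int (c (n + 2)) * expi (2 * z) ^ (n + 2)) sums (hecke p z - t * Delta z)"
      using c_sums[OF that] c01 by (subst sums_iff_shift) (simp add: numeral_2_eq_2)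
    then have "(\<lambda>n. of_int (c (n + 2)) * expi (2 * z) ^ (n + 2) / expi (2 * z) ^ 2) sums ((hecke p z - t * Delta z) / expi (2 * z) ^ 2)"
      by (rule sums_divide)
    then show ?thesis by (simp add: F_def power2_eq_square)
  qed
  have radius: "fps_conv_radius F \<ge> 1"
    unfolding fps_conv_radius_def
  proof (rule conv_radius_geI_ex)
    fix r :: real assume r: "0 < r" "ereal r < 1"
    obtain z where z: "Im z > 0" "expi (2 * z) = of_real r"
      using nome_exists[of "of_real r"] r by (auto simp: one_ereal_def)
    then show "\<exists>w. norm w = r \<and> summable (\<lambda>n. fps_nth F n * w ^ n)"
      using F_sums[OF z(1)] r by (intro exI[of _ "of_real r"]) (auto simp: sums_iff)
  qed
  define H where "H q = eval_fps (fps_X * F) q / euler_prod q 1 ^ 24" for q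
  have XF: "eval_fps (fps_X * F) q = q * eval_fps F q" if "norm q < 1" for q
    using that radius by (subst eval_fps_mult) (auto intro: less_le_trans[of _ "1 :: ereal"] simp: one_ereal_def)
  have radius': "fps_conv_radius (fps_X * F) \<ge> 1"
    using fps_conv_radius_mult[of fps_X F] radius by simp
  have H_holo: "H holomorphic_on ball 0 1"
    unfolding H_def[abs_def]
  proof (intro holomorphic_intros euler_prod_q_holomorphic)
    show "ball (0 :: complex) 1 \<subseteq> eball 0 (fps_conv_radius (fps_X * F))"
      using ball_eball_mono[of 1 "fps_conv_radius (fps_X * F)" "0 :: complex"] radius' by (simp add: one_ereal_def)
  qed (use euler_prod_1_nonzero in auto)
  have H_Delta: "H (expi (2 * z)) = (hecke p z - t * Delta z) / Delta z" if "Im z > 0" for z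
  proof -
    have "eval_fps F (expi (2 * z)) = (hecke p z - t * Delta z) / expi (2 * z) ^ 2"
      using F_sums[OF that] by (simp add: eval_fps_def sums_iff)
    then show ?thesis
      using XF[OF norm_nome_less_1[OF that]]
      by (simp add: H_def Delta_def Delta_q_def power2_eq_square)
  qed
  have H_inv: "H (expi (2 * (- 1 / z))) = H (expi (2 * z))" if "Im z > 0" for z
  proof -
    have "H (expi (2 * (- 1 / z))) = (z ^ 12 * (hecke p z - t * Delta z)) / (z ^ 12 * Delta z)"
      unfolding H_Delta[OF Im_neg_inverse[OF that]] hecke_neg_inverse[OF p that] Delta_neg_inverse[OF that]
      by (simp add: algebra_simps)
    also have "\<dots> = H (expi (2 * z))"
      using that by (subst mult_divide_mult_cancel_left) (auto simp: H_Delta)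
    finally show ?thesis .
  qed
  \<comment> \<open>the nomes of modulus \<open>\<rho>\<close> are those of the points with imaginary part \<open>1/2\<close>\<close>
  define \<rho> where "\<rho> = exp (- pi)"
  have \<rho>: "0 < \<rho>" "\<rho> < 1" by (simp_all add: \<rho>_def)
  have "continuous_on (cball 0 \<rho>) (\<lambda>q. norm (H q))"
    using \<rho> by (intro continuous_intros continuous_on_subset[OF holomorphic_on_imp_continuous_on[OF H_holo]]) auto
  then obtain q0 where q0: "q0 \<in> cball 0 \<rho>" "\<And>q. q \<in> cball 0 \<rho> \<Longrightarrow> norm (H q) \<le> norm (H q0)"
    using continuous_attains_sup[of "cball 0 \<rho>" "\<lambda>q. norm (H q)"] \<rho> by auto
  obtain q1 where q1: "norm q1 < \<rho>" "norm (H q1) = norm (H q0)"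
  proof (cases "norm q0 < \<rho>")
    case False
    then have nq0: "norm q0 = \<rho>" using q0(1) by simp
    obtain z where z: "Im z > 0" "expi (2 * z) = q0" "\<bar>Re z\<bar> \<le> 1 / 2" "norm q0 = exp (- 2 * pi * Im z)"
      by (rule nome_exists[of q0]) (use nq0 \<rho> in auto)
    have im: "Im z = 1 / 2" using z(4) nq0 by (simp add: \<rho>_def)
    have "(Re z)\<^sup>2 \<le> (1 / 2)\<^sup>2" using z(3) by (rule power2_le_iff_abs_le[THEN iffD2, rotated]) simp
    then have "(Re z)\<^sup>2 + (Im z)\<^sup>2 \<le> 1 / 2" unfolding im by (simp add: power2_eq_square)
    moreover have "(Re z)\<^sup>2 + (Im z)\<^sup>2 > 0" using im by (simp add: sum_power2_gt_zero_iff)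
    moreover have "Im (- 1 / z) = Im z / ((Re z)\<^sup>2 + (Im z)\<^sup>2)" by (simp add: Im_divide)
    then have "Im (- 1 / z) = (1 / 2) / ((Re z)\<^sup>2 + (Im z)\<^sup>2)" by (simp only: im)
    ultimately have "Im (- 1 / z) \<ge> 1"
      by (simp only: le_divide_eq_1_pos)
    moreover have "norm (expi (2 * w)) \<le> exp (- 2 * pi)" if "Im w \<ge> 1" for w
      using that by (simp add: norm_expi)
    ultimately have "norm (expi (2 * (- 1 / z))) \<le> exp (- 2 * pi)" by blast
    also have "\<dots> < \<rho>" by (simp add: \<rho>_def)
    finally show ?thesis using that H_inv[OF z(1)] z(2) by metis
  qed (use that in blast)
  have "H constant_on ball 0 \<rho>"
  proof (rule maximum_modulus_principle[where U = "ball 0 \<rho>" and \<xi> = q1])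
    show "H holomorphic_on ball 0 \<rho>" by (rule holomorphic_on_subset[OF H_holo]) (use \<rho> in auto)
  qed (use q0 q1 in auto)
  moreover have "H 0 = 0" using XF[of 0] by (simp add: H_def)
  ultimately have H0: "H q = 0" if "norm q < \<rho>" for q
    using that \<rho> by (metis constant_on_def dist_0_norm mem_ball norm_zero)
  have "fps_X * F = 0"
  proof (rule eval_fps_eqD)
    have "eventually (\<lambda>q. q \<in> ball 0 \<rho>) (nhds (0::complex))" using \<rho> by (intro eventually_nhds_in_open) auto
    then show "eventually (\<lambda>q. eval_fps (fps_X * F) q = eval_fps 0 q) (nhds 0)"
    proof eventually_elim
      case (elim q)
      then have "H q = 0" "norm q < 1" using H0 \<rho> by auto
      then show ?case using euler_prod_1_nonzero by (simp add: H_def)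
    qed
  qed (use radius' in \<open>auto intro: less_le_trans[of _ "1 :: ereal"]\<close>)
  then have "F = 0" by simp
  moreover have "fps_nth F m = of_int (c (Suc (Suc m)))" for m by (simp add: F_def)
  ultimately have "c (Suc (Suc m)) = 0" for m by simp
  then have "c n = 0"
    using c01 by (metis One_nat_def not0_implies_Suc)
  then show ?thesis by (simp add: c_def)
qed

section \<open>Lucas sequences\<close>

text \<open>The coefficients of \<open>(s + \<surd>d) ^ n = lucasW s P n + lucasU s P n * \<surd>d\<close>, where \<open>d = s\<^sup>2 - P\<close>. Thus
\<open>lucasU s P\<close> is the Lucas sequence with trace \<open>2 s\<close> and norm \<open>P\<close>.\<close>

fun lucasU lucasW :: "int \<Rightarrow> int \<Rightarrow> nat \<Rightarrow> int" where
  "lucasU s P 0 = 0"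
| "lucasW s P 0 = 1"
| "lucasU s P (Suc n) = lucasW s P n + s * lucasU s P n"
| "lucasW s P (Suc n) = s * lucasW s P n + (s\<^sup>2 - P) * lucasU s P n"

lemma lucasU_rec: "lucasU s P (Suc (Suc n)) = 2 * s * lucasU s P (Suc n) - P * lucasU s P n"
  by (simp add: algebra_simps power2_eq_square)

text \<open>Multiplicativity of the norm of \<open>s + \<surd>d\<close>.\<close>

lemma lucas_norm: "(lucasW s P n)\<^sup>2 + (P - s\<^sup>2) * (lucasU s P n)\<^sup>2 = P ^ n"
proof (induction n)
  case (Suc n)
  have "(lucasW s P (Suc n))\<^sup>2 + (P - s\<^sup>2) * (lucasU s P (Suc n))\<^sup>2 =
      P * ((lucasW s P n)\<^sup>2 + (P - s\<^sup>2) * (lucasU s P n)\<^sup>2)"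
    by (simp add: algebra_simps power2_eq_square)
  then show ?case using Suc.IH by simp
qed simp

lemma even_lucasU: "even (lucasU s P (2 * m))"
proof (induction m)
  case (Suc m)
  have "2 * Suc m = Suc (Suc (2 * m))" by simp
  then show ?case using Suc.IH by (simp only: lucasU_rec) simp
qed simp

lemma square_dvd_lucasU:
  assumes "p dvd s" "p\<^sup>2 dvd P" "n \<ge> 3"
  shows "p\<^sup>2 dvd lucasU s P n"
proof -
  obtain m where n: "n = Suc (Suc (Suc m))"
    using assms(3) by (metis numeral_3_eq_3 less_eqE add_Suc)
  have "p dvd P" using assms(2) by (metis dvd_trans dvd_triv_left power2_eq_square)
  then have "p dvd lucasU s P (Suc (Suc m))" using assms(1) unfolding lucasU_rec by simp
  then have "p * p dvd s * lucasU s P (Suc (Suc m))" using assms(1) by (intro mult_dvd_mono)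
  then show ?thesis
    using assms(2) unfolding n lucasU_rec power2_eq_square by (metis dvd_diff dvd_mult dvd_mult2 mult.assoc)
qed

text \<open>Modulo \<open>P\<close> both sequences are geometric with ratio \<open>2 s\<close> from index 1 on.\<close>

lemma not_dvd_lucas:
  assumes "prime p" "p dvd P" "\<not> p dvd 2 * s"
  shows "\<not> p dvd lucasW s P (Suc n)"
proof -
  have W: "p dvd lucasW s P (Suc n) - s * lucasU s P (Suc n)" for n
  proof -
    have "lucasW s P (Suc n) - s * lucasU s P (Suc n) = - (P * lucasU s P n)"
      by (simp add: algebra_simps power2_eq_square)
    then show ?thesis using assms(2) by simp
  qed
  have U: "\<not> p dvd lucasU s P (Suc n)" for n
  proof (induction n)
    case 0
    then show ?case using assms(1) not_prime_unit by auto
  next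
    case (Suc n)
    have "p dvd P * lucasU s P n" using assms(2) by simp
    moreover have "\<not> p dvd 2 * s * lucasU s P (Suc n)"
      using Suc.IH assms(1,3) prime_dvd_mult_iff by metis
    ultimately show ?case unfolding lucasU_rec by (metis diff_add_cancel dvd_add)
  qed
  have "\<not> p dvd s" using assms(3) by auto
  then have "\<not> p dvd s * lucasU s P (Suc n)" using U assms(1) prime_dvd_mult_iff by metis
  then show ?thesis using W[of n] by (metis diff_diff_eq2 add_diff_cancel_left' dvd_diff)
qed

lemma lucas_minus: "lucasU (- s) P n = (-1) ^ Suc n * lucasU s P n \<and> lucasW (- s) P n = (-1) ^ n * lucasW s P n"
  by (induction n) (auto simp: algebra_simps)

lemma lucasU_ge:
  assumes "s \<ge> 0" "P \<le> s\<^sup>2"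
  shows "lucasU s P (Suc n) \<ge> s ^ n"
proof -
  have nn: "lucasU s P n \<ge> 0 \<and> lucasW s P n \<ge> 0" for n
    using assms by (induction n) auto
  show ?thesis
  proof (induction n)
    case (Suc n)
    have "s ^ Suc n \<le> s * lucasU s P (Suc n)" using Suc.IH assms(1) by (simp add: mult_left_mono del: lucasU.simps)
    also have "\<dots> \<le> lucasU s P (Suc (Suc n))" using nn[of "Suc n"] by simp
    finally show ?case .
  qed simp
qed

text \<open>For \<open>s \<ge> 0\<close> and \<open>d = s\<^sup>2 - P \<ge> 0\<close> both coefficients of \<open>(s + \<surd>d) ^ n\<close> are nonnegative, so that each
step multiplies the second one by at least \<open>s\<close>. A change of the sign of \<open>s\<close> does not affect the
absolute value.\<close>

lemma abs_lucasU_ge: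
  assumes "P \<le> s\<^sup>2"
  shows "\<bar>lucasU s P (Suc n)\<bar> \<ge> \<bar>s\<bar> ^ n"
proof -
  have "\<bar>lucasU \<bar>s\<bar> P (Suc n)\<bar> = \<bar>lucasU s P (Suc n)\<bar>"
    using lucas_minus[of s P "Suc n"] by (cases "s \<ge> 0") (auto simp: abs_mult power_abs simp del: lucasU.simps)
  moreover have "\<bar>s\<bar> ^ n \<le> lucasU \<bar>s\<bar> P (Suc n)"
    by (rule lucasU_ge) (use assms in auto)
  ultimately show ?thesis by linarith
qed

section \<open>Tau at prime powers\<close>

lemma even_ramanujan_tau_prime:
  assumes "prime p"
  shows "even (ramanujan_tau p)"
proof (rule ccontr)
  assume "odd (ramanujan_tau p)"
  then obtain s where "p = (2 * s + 1)\<^sup>2" using odd_ramanujan_tau_imp_odd_square by blast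
  then show False using assms by (simp add: prime_power_iff)
qed

lemma ramanujan_tau_prime_power:
  assumes p: "prime p" and s: "ramanujan_tau p = 2 * s"
  shows "ramanujan_tau (p ^ k) = lucasU s (int p ^ 11) (Suc k)"
proof (induction k rule: less_induct)
  case (less k)
  consider "k = 0" | "k = 1" | j where "k = Suc (Suc j)" by (metis One_nat_def not0_implies_Suc)
  then show ?case
  proof cases
    case (3 j)
    have p0: "p > 0" using p prime_gt_0_nat by blast
    have "2 * s * ramanujan_tau (p ^ Suc j) = ramanujan_tau (p ^ k) + int p ^ 11 * ramanujan_tau (p ^ j)"
      using ramanujan_tau_hecke[OF p, of "p ^ Suc j"] p0 by (simp add: s 3)
    then show ?thesis using less[of j] less[of "Suc j"] unfolding 3 lucasU_rec by simp
  qed (simp_all add: ramanujan_tau_1[unfolded One_nat_def] s)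
qed

lemma ramanujan_tau_mult:
  assumes p: "prime p" and m: "\<not> p dvd m"
  shows "ramanujan_tau (p ^ k * m) = ramanujan_tau (p ^ k) * ramanujan_tau m"
proof (induction k rule: less_induct)
  case (less k)
  have p0: "p > 0" using p prime_gt_0_nat by blast
  consider "k = 0" | "k = 1" | j where "k = Suc (Suc j)" by (metis One_nat_def not0_implies_Suc)
  then show ?case
  proof cases
    case 1
    then show ?thesis by (simp add: ramanujan_tau_1[unfolded One_nat_def])
  next
    case 2
    then show ?thesis using ramanujan_tau_hecke[OF p, of m] m by simp
  next
    case (3 j)
    have 1: "ramanujan_tau p * ramanujan_tau (p ^ Suc j) = ramanujan_tau (p ^ k) + int p ^ 11 * ramanujan_tau (p ^ j)"
      using ramanujan_tau_hecke[OF p, of "p ^ Suc j"] p0 by (simp add: 3)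
    have 2: "ramanujan_tau p * ramanujan_tau (p ^ Suc j * m) = ramanujan_tau (p ^ k * m) + int p ^ 11 * ramanujan_tau (p ^ j * m)"
      using ramanujan_tau_hecke[OF p, of "p ^ Suc j * m"] p0 by (simp add: 3 mult.assoc)
    have 3: "ramanujan_tau (p ^ j * m) = ramanujan_tau (p ^ j) * ramanujan_tau m"
      "ramanujan_tau (p ^ Suc j * m) = ramanujan_tau (p ^ Suc j) * ramanujan_tau m"
      using less[of j] less[of "Suc j"] 3 by simp_all
    have "ramanujan_tau (p ^ k * m) = ramanujan_tau p * ramanujan_tau (p ^ Suc j * m) - int p ^ 11 * ramanujan_tau (p ^ j * m)"
      using 2 by simp
    also have "\<dots> = (ramanujan_tau p * ramanujan_tau (p ^ Suc j) - int p ^ 11 * ramanujan_tau (p ^ j)) * ramanujan_tau m"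
      unfolding 3 by (simp add: algebra_simps)
    also have "\<dots> = ramanujan_tau (p ^ k) * ramanujan_tau m" unfolding 1 by simp
    finally show ?thesis .
  qed
qed

text \<open>Split off the full power of one prime dividing \<open>n\<close>: one of the two factors of \<open>\<tau>(n)\<close> is \<open>\<plusminus>l\<close>, the
other is \<open>\<plusminus>1\<close>.\<close>

lemma prime_value_at_prime_power:
  assumes l: "prime l" and n: "n \<ge> 1" and tau: "\<bar>ramanujan_tau n\<bar> = int l"
  shows "\<exists>p k. prime p \<and> \<bar>ramanujan_tau (p ^ k)\<bar> = int l"
  using n tau
proof (induction n rule: less_induct)
  case (less n)
  have "n \<noteq> 1" using less.prems(2) prime_gt_1_nat[OF l] ramanujan_tau_1 by auto
  then obtain p where p: "prime p" "p dvd n" using prime_factor_nat by blast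
  have n0: "n \<noteq> 0" using less.prems by simp
  have "\<not> is_unit p" using p(1) not_prime_unit by blast
  with n0 obtain m where m: "n = p ^ multiplicity p n * m" "\<not> p dvd m"
    by (rule multiplicity_decompose')
  define k where "k = multiplicity p n"
  have prod: "\<bar>ramanujan_tau (p ^ k)\<bar> * \<bar>ramanujan_tau m\<bar> = int l"
    using less.prems(2) ramanujan_tau_mult[OF p(1) m(2), of k] m(1) by (simp add: k_def abs_mult)
  then have "nat \<bar>ramanujan_tau (p ^ k)\<bar> * nat \<bar>ramanujan_tau m\<bar> = l"
    by (metis abs_ge_zero nat_int nat_mult_distrib)
  then have "nat \<bar>ramanujan_tau (p ^ k)\<bar> = 1 \<or> nat \<bar>ramanujan_tau m\<bar> = 1"
    using l by (metis prime_product)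
  then show ?case
  proof
    assume "nat \<bar>ramanujan_tau m\<bar> = 1"
    then have "\<bar>ramanujan_tau (p ^ k)\<bar> = int l" using prod by (simp add: nat_eq_iff)
    then show ?thesis using p(1) by blast
  next
    assume "nat \<bar>ramanujan_tau (p ^ k)\<bar> = 1"
    then have tm: "\<bar>ramanujan_tau m\<bar> = int l" using prod by (simp add: nat_eq_iff)
    have "m \<noteq> 0" using n0 m(1) by (metis mult_0_right)
    have "multiplicity p n > 0"
      using p n0 \<open>\<not> is_unit p\<close> by (simp add: multiplicity_gt_zero_iff)
    then have "p ^ multiplicity p n > 1"
      using prime_gt_1_nat[OF p(1)] by (intro one_less_power)
    then have "1 * m < p ^ multiplicity p n * m" using \<open>m \<noteq> 0\<close> by (intro mult_strict_right_mono) auto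
    then have "m < n" using m(1) by linarith
    then show ?thesis using less.IH[of m] tm \<open>m \<noteq> 0\<close> by simp
  qed
qed

section \<open>The bound from the abc conjecture\<close>

lemma rad_le:
  assumes "M > 0" "\<And>q. prime q \<Longrightarrow> q dvd m \<Longrightarrow> q dvd M"
  shows "0 < rad m" "rad m \<le> M"
proof -
  have pos: "q > 0" if "q \<in> prime_factors m" for q :: int
    using that prime_gt_0_int by auto
  then show "0 < rad m" unfolding rad_def by (intro prod_pos) auto
  have "(\<Prod>q\<in>A. q) dvd M" if "finite A" "A \<subseteq> prime_factors m" for A
    using that
  proof (induction A)
    case (insert q A)
    have "q dvd M" using insert.prems assms(2) by auto
    moreover have "coprime q (\<Prod>q\<in>A. q)"
      using insert by (intro prod_coprime_right primes_coprime) auto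
    ultimately show ?case using insert by (simp add: divides_mult)
  qed simp
  from this[OF finite_set_mset order_refl] show "rad m \<le> M"
    unfolding rad_def using assms(1) by (intro zdvd_imp_le) auto
qed

text \<open>The conjecture is applied to \<open>W\<^sup>2 + (P - s\<^sup>2) U\<^sup>2 = P ^ N\<close> with \<open>P = p ^ 11\<close>. As
\<open>11 N / 2 + 12 \<le> 19 N / 2\<close> for \<open>N \<ge> 3\<close>, the radical is at most \<open>p ^ (19 N / 2) l\<close>; the exponent
\<open>1 + 1/19\<close> turns \<open>19 N / 2\<close> into \<open>10 N\<close>, one \<open>N\<close> less than on the left.\<close>

lemma abc_imp_prime_power_bound:
  assumes abc: abc_conjecture
  obtains C :: real where "C \<ge> 1" and
    "\<And>l p s N. prime (l::nat) \<Longrightarrow> prime (p::nat) \<Longrightarrow> odd p \<Longrightarrow> \<not> int p dvd s \<Longrightarrow> N \<ge> 3 \<Longrightarrow> s\<^sup>2 < int p ^ 11 \<Longrightarrow>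
       \<bar>lucasU s (int p ^ 11) N\<bar> = int l \<Longrightarrow> real p ^ N \<le> C * real l powr (20 / 19)"
proof -
  have "\<exists>C::real. C > 0 \<and> (\<forall>a b c :: int. a \<noteq> 0 \<longrightarrow> b \<noteq> 0 \<longrightarrow> c \<noteq> 0 \<longrightarrow> Gcd {a, b, c} = 1 \<longrightarrow> a + b = c \<longrightarrow>
      of_int \<bar>c\<bar> \<le> C * of_int (rad (a * b * c)) powr (1 + 1 / 19))"
    by (rule abc[unfolded abc_conjecture_def, THEN spec, THEN mp]) simp
  then obtain C :: real where C: "C > 0" "\<forall>a b c :: int. a \<noteq> 0 \<longrightarrow> b \<noteq> 0 \<longrightarrow> c \<noteq> 0 \<longrightarrow> Gcd {a, b, c} = 1 \<longrightarrow> a + b = c \<longrightarrow>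
      of_int \<bar>c\<bar> \<le> C * of_int (rad (a * b * c)) powr (1 + 1 / 19)"
    by (elim exE conjE)
  show ?thesis
  proof (rule that[of "max C 1"])
    show "max C 1 \<ge> 1" by simp
    fix l p N :: nat and s :: int
    assume l: "prime l" and p: "prime p" "odd p" and s: "\<not> int p dvd s" and N: "N \<ge> 3"
      and small: "s\<^sup>2 < int p ^ 11" and U: "\<bar>lucasU s (int p ^ 11) N\<bar> = int l"
    define P where "P = int p ^ 11"
    define W where "W = lucasW s P N"
    define e where "e = P - s\<^sup>2"
    have p1: "p > 1" and l0: "l > 0" using p l prime_gt_1_nat prime_gt_0_nat by auto
    have e: "0 < e" "e \<le> P" using small by (simp_all add: e_def P_def)
    have eq: "W\<^sup>2 + e * (int l)\<^sup>2 = P ^ N"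
      using lucas_norm[of s P N] U by (simp add: W_def e_def P_def flip: power2_abs[of "lucasU _ _ _"])
    have pp: "prime (int p)" using p(1) by simp
    have "\<not> int p dvd 2" 
    proof
      assume "int p dvd 2"
      then have "p dvd 2" by (metis int_dvd_int_iff of_nat_numeral)
      then have "p \<le> 2" by (simp add: dvd_imp_le)
      then show False using p1 p(2) by (cases "p = 2") auto
    qed
    then have "\<not> int p dvd 2 * s" using s pp prime_dvd_mult_iff by blast
    moreover obtain N' where "N = Suc N'" using N by (cases N) auto
    ultimately have pW: "\<not> int p dvd W"
      using not_dvd_lucas[OF pp, of P s N'] by (simp add: W_def P_def)
    have PN: "P ^ N = int p ^ (11 * N)" by (simp add: P_def power_mult)
    have "coprime (int p) W" using pp pW by (rule prime_imp_coprime)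
    then have "coprime (W\<^sup>2) (P ^ N)" unfolding PN by (simp add: coprime_commute)
    then have g: "Gcd {W\<^sup>2, e * (int l)\<^sup>2, P ^ N} = 1"
      by (simp add: coprime_iff_gcd_eq_1[symmetric] gcd.left_commute[of "W\<^sup>2"])
    have W0: "W \<noteq> 0" using pW by auto
    then have W2: "W\<^sup>2 \<noteq> 0" by simp
    have nz: "e * (int l)\<^sup>2 \<noteq> 0" "P ^ N \<noteq> 0" using e l0 p1 by (auto simp: P_def)
    note main = C(2)[rule_format, OF W2 nz g eq]
    define r where "r = rad (W\<^sup>2 * (e * (int l)\<^sup>2) * P ^ N)"
    have M0: "\<bar>W\<bar> * e * int l * int p > 0" using W0 e l0 p1 by simp
    have r: "0 < r" "r \<le> \<bar>W\<bar> * e * int l * int p"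
    proof -
      have "q dvd \<bar>W\<bar> * e * int l * int p" if "prime q" "q dvd W\<^sup>2 * (e * (int l)\<^sup>2) * P ^ N" for q
        using that by (auto simp: prime_dvd_mult_iff prime_dvd_power_iff PN dest: prime_dvd_power)
      then show "0 < r" "r \<le> \<bar>W\<bar> * e * int l * int p"
        using rad_le[OF M0] unfolding r_def by blast+
    qed
    define x where "x = real p"
    have x1: "x > 1" using p1 by (simp add: x_def)
    have "W\<^sup>2 \<le> P ^ N" using eq e by (metis le_add_same_cancel1 mult_nonneg_nonneg less_imp_le zero_le_power2)
    then have "real_of_int (W\<^sup>2) \<le> real_of_int (P ^ N)" by (simp only: of_int_le_iff)
    then have "(real_of_int \<bar>W\<bar>)\<^sup>2 \<le> x ^ (11 * N)"
      unfolding PN x_def by simp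
    also have "\<dots> = (x powr (11 * real N / 2))\<^sup>2"
    proof -
      have "(x powr (11 * real N / 2))\<^sup>2 = x powr real (11 * N)"
        unfolding power2_eq_square powr_add[symmetric] by simp
      also have "\<dots> = x ^ (11 * N)" using x1 by (intro powr_realpow) simp
      finally show ?thesis ..
    qed
    finally have Wle: "real_of_int \<bar>W\<bar> \<le> x powr (11 * real N / 2)"
      by (rule power2_le_imp_le) simp
    have ele: "real_of_int e \<le> x powr 11"
    proof -
      have "real_of_int e \<le> real_of_int P" using e by simp
      also have "\<dots> = x powr 11" using x1 by (simp add: P_def x_def powr_numeral)
      finally show ?thesis .
    qed
    have "real_of_int r \<le> real_of_int (\<bar>W\<bar> * e * int l * int p)" using r(2) by (simp only: of_int_le_iff)
    also have "\<dots> = real_of_int \<bar>W\<bar> * real_of_int e * real l * x" by (simp add: x_def)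
    also have "\<dots> \<le> x powr (11 * real N / 2) * x powr 11 * real l * x"
      using Wle ele e x1 by (intro mult_right_mono mult_mono) auto
    also have "\<dots> = x powr (11 * real N / 2 + 12) * real l"
      using x1 power_Suc2[of x 11] by (simp add: powr_add powr_numeral)
    also have "\<dots> \<le> x powr (19 * real N / 2) * real l"
      using x1 N by (intro mult_right_mono powr_mono) auto
    finally have "real_of_int r powr (1 + 1 / 19) \<le> (x powr (19 * real N / 2) * real l) powr (1 + 1 / 19)"
      using r(1) by (intro powr_mono2) auto
    also have "\<dots> = x powr (10 * real N) * real l powr (20 / 19)"
      using x1 by (simp add: powr_mult powr_powr)
    finally have "C * real_of_int r powr (1 + 1 / 19) \<le> C * (x powr (10 * real N) * real l powr (20 / 19))"
      using C(1) by (intro mult_left_mono) auto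
    moreover have "of_int \<bar>P ^ N\<bar> = x powr (11 * real N)"
    proof -
      have "of_int \<bar>P ^ N\<bar> = x ^ (11 * N)" by (simp add: PN x_def)
      also have "\<dots> = x powr real (11 * N)" using x1 by (intro powr_realpow[symmetric]) simp
      finally show ?thesis by simp
    qed
    ultimately have "x powr (11 * real N) \<le> C * (x powr (10 * real N) * real l powr (20 / 19))"
      using main by (simp add: r_def)
    moreover have "x powr (11 * real N) = x powr (10 * real N) * x ^ N"
    proof -
      have "x ^ N = x powr real N" using x1 by (intro powr_realpow[symmetric]) simp
      then show ?thesis by (simp add: powr_add[symmetric])
    qed
    ultimately have "x powr (10 * real N) * x ^ N \<le> x powr (10 * real N) * (C * real l powr (20 / 19))"
      by (simp add: mult_ac)
    then have "x ^ N \<le> C * real l powr (20 / 19)"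
      using x1 by simp
    also have "\<dots> \<le> max C 1 * real l powr (20 / 19)" by (intro mult_right_mono) auto
    finally show "real p ^ N \<le> max C 1 * real l powr (20 / 19)" by (simp add: x_def)
  qed
qed

text \<open>Oddness of \<open>l\<close> excludes odd exponents \<open>k\<close> and \<open>p = 2\<close>; primality of \<open>l\<close> excludes that \<open>p\<close> divides \<open>s\<close>.
When \<open>s\<^sup>2 \<ge> p ^ 11\<close> the bound follows from the growth of \<open>lucasU\<close> instead of the conjecture.\<close>

lemma abc_imp_small_prime_power:
  assumes abc: abc_conjecture
  obtains C :: real where "C \<ge> 1" and
    "\<And>l n. prime (l::nat) \<Longrightarrow> odd l \<Longrightarrow> n \<ge> 1 \<Longrightarrow> \<bar>ramanujan_tau n\<bar> = int l \<Longrightarrow>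
       \<exists>p N. p \<ge> 2 \<and> N \<ge> 3 \<and> real (p ^ N) \<le> C * real l powr (20 / 19) \<and> \<bar>ramanujan_tau (p ^ (N - 1))\<bar> = int l"
proof -
  obtain C :: real where C: "C \<ge> 1" and
    bound: "\<And>l p s N. prime (l::nat) \<Longrightarrow> prime (p::nat) \<Longrightarrow> odd p \<Longrightarrow> \<not> int p dvd s \<Longrightarrow> N \<ge> 3 \<Longrightarrow> s\<^sup>2 < int p ^ 11 \<Longrightarrow>
       \<bar>lucasU s (int p ^ 11) N\<bar> = int l \<Longrightarrow> real p ^ N \<le> C * real l powr (20 / 19)"
    using abc_imp_prime_power_bound[OF abc] by blast
  show ?thesis
  proof (rule that[OF C])
    fix l n :: nat
    assume l: "prime l" "odd l" and n: "n \<ge> 1" "\<bar>ramanujan_tau n\<bar> = int l"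
    obtain p k where p: "prime p" and tau: "\<bar>ramanujan_tau (p ^ k)\<bar> = int l"
      using prime_value_at_prime_power[OF l(1) n] by blast
    obtain s where s: "ramanujan_tau p = 2 * s" using even_ramanujan_tau_prime[OF p] by (elim evenE)
    define P where "P = int p ^ 11"
    have U: "\<bar>lucasU s P (Suc k)\<bar> = int l"
      using tau ramanujan_tau_prime_power[OF p s, of k] by (simp add: P_def)
    have p1: "p > 1" and l1: "l > 1" using p l prime_gt_1_nat by auto
    have "even k"
    proof (rule ccontr)
      assume "odd k"
      then obtain m where m: "Suc k = 2 * m" by (metis evenE even_Suc)
      have "even (lucasU s P (Suc k))" unfolding m by (rule even_lucasU)
      then have "even (int l)" unfolding U[symmetric] by (rule dvd_abs_iff[THEN iffD2])
      then show False using l(2) by simp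
    qed
    then obtain m where k: "k = 2 * m" by (elim evenE)
    have "m \<noteq> 0"
    proof
      assume "m = 0"
      then show False using U l1 k by simp
    qed
    then have m: "m \<ge> 1" by simp
    have ps: "\<not> int p dvd s"
    proof
      assume ps: "int p dvd s"
      have "(int p)\<^sup>2 dvd P" unfolding P_def by (rule le_imp_power_dvd) simp
      then have "(int p)\<^sup>2 dvd lucasU s P (Suc k)"
        using ps m k by (intro square_dvd_lucasU) auto
      then have "(int p)\<^sup>2 dvd int l" using U by (metis dvd_abs_iff)
      then have "p\<^sup>2 dvd l" by (simp flip: of_nat_power)
      then have "p dvd l" "p * p \<le> l"
        using l1 by (auto simp: power2_eq_square dvd_mult_left dvd_imp_le)
      then have "p * p \<le> p" using p l(1) primes_dvd_imp_eq[of p l] by simp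
      then show False using p1 by simp
    qed
    have "odd p"
    proof
      assume "even p"
      then have "p = 2" using p primes_dvd_imp_eq two_is_prime_nat by blast
      then have "even P" by (simp add: P_def)
      moreover have "Suc k = Suc (Suc (2 * m - 1))" using m k by simp
      ultimately have "even (lucasU s P (Suc k))" by (simp only: lucasU_rec) simp
      then have "even (int l)" unfolding U[symmetric] by (rule dvd_abs_iff[THEN iffD2])
      then show False using l(2) by simp
    qed
    have "real p ^ (Suc k) \<le> C * real l powr (20 / 19)"
    proof (cases "s\<^sup>2 < P")
      case True
      then show ?thesis using bound[OF l(1) p \<open>odd p\<close> ps, of "Suc k"] U m k by (simp add: P_def)
    next
      case False
      have "int p ^ Suc k \<le> int p ^ (11 * m)" using p1 m k by (intro power_increasing) auto
      also have "\<dots> = P ^ m" by (simp add: P_def power_mult)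
      also have "\<dots> \<le> (s\<^sup>2) ^ m" using False by (intro power_mono) (auto simp: P_def)
      also have "\<dots> = \<bar>s\<bar> ^ k" by (simp add: k power_mult)
      also have "\<dots> \<le> int l" using abs_lucasU_ge[of P s k] False U by simp
      finally have "int (p ^ Suc k) \<le> int l" by simp
      then have "real (p ^ Suc k) \<le> real l" by (simp only: of_nat_le_iff)
      also have "\<dots> = 1 * real l powr 1" using l1 by simp
      also have "\<dots> \<le> C * real l powr (20 / 19)" using C l1 by (intro mult_mono powr_mono) auto
      finally show ?thesis by simp
    qed
    then show "\<exists>p N. p \<ge> 2 \<and> N \<ge> 3 \<and> real (p ^ N) \<le> C * real l powr (20 / 19) \<and> \<bar>ramanujan_tau (p ^ (N - 1))\<bar> = int l"
      using p1 m k tau by (intro exI[of _ p] exI[of _ "Suc k"]) auto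
  qed
qed

section \<open>Counting prime values\<close>

theorem theorem1:
  assumes abc_conjecture
  shows "(\<lambda>X::real. real (tau_prime_count X)) \<in> O[at_top](\<lambda>X. X powr (13 / 22))"
proof -
  obtain C :: real where C: "C \<ge> 1" and small:
    "\<And>l n. prime (l::nat) \<Longrightarrow> odd l \<Longrightarrow> n \<ge> 1 \<Longrightarrow> \<bar>ramanujan_tau n\<bar> = int l \<Longrightarrow>
       \<exists>p N. p \<ge> 2 \<and> N \<ge> 3 \<and> real (p ^ N) \<le> C * real l powr (20 / 19) \<and> \<bar>ramanujan_tau (p ^ (N - 1))\<bar> = int l"
    using abc_imp_small_prime_power[OF assms] by blast
  have count: "real (tau_prime_count X) \<le> 1 + (C * X powr (20 / 19)) powr (1 / 3) * (log 2 (C * X powr (20 / 19)) + 1)"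
    if X: "X \<ge> 2" for X
  proof -
    define Y where "Y = C * X powr (20 / 19)"
    have "1 * 1 \<le> C * X powr (20 / 19)"
      using C X by (intro mult_mono ge_one_powr_ge_zero) auto
    then have Y: "Y \<ge> 1" by (simp add: Y_def)
    \<comment> \<open>\<open>p ^ 3 \<le> p ^ N \<le> Y\<close> bounds \<open>p\<close>, and \<open>2 ^ N \<le> p ^ N \<le> Y\<close> bounds \<open>N\<close>\<close>
    define T where "T = {1..nat \<lfloor>Y powr (1 / 3)\<rfloor>} \<times> {..nat \<lfloor>log 2 Y\<rfloor>}"
    define f where "f = (\<lambda>(p, N). nat \<bar>ramanujan_tau (p ^ (N - 1))\<bar>)"
    have "{l :: nat. real l \<le> X \<and> prime l \<and> (\<exists>n\<ge>1. \<bar>ramanujan_tau n\<bar> = int l)} \<subseteq> insert 2 (f ` T)"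
    proof safe
      fix l n :: nat
      assume l: "real l \<le> X" "prime l" "l \<notin> f ` T" and n: "n \<ge> 1" "\<bar>ramanujan_tau n\<bar> = int l"
      show "l = 2"
      proof (rule ccontr)
        assume "l \<noteq> 2"
        then have "odd l" using l(2) primes_dvd_imp_eq two_is_prime_nat by blast
        then obtain p N where p: "p \<ge> 2" "N \<ge> 3" "real (p ^ N) \<le> C * real l powr (20 / 19)"
          "\<bar>ramanujan_tau (p ^ (N - 1))\<bar> = int l"
          using small[OF l(2) _ n] by blast
        have "C * real l powr (20 / 19) \<le> Y"
          unfolding Y_def using C l(1) by (intro mult_left_mono powr_mono2) auto
        then have pN: "real p ^ N \<le> Y" using p(3) by simp
        have "real p ^ 3 \<le> real p ^ N" using p by (intro power_increasing) auto
        then have "real p ^ 3 \<le> Y" using pN by linarith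
        then have "(real p ^ 3) powr (1 / 3) \<le> Y powr (1 / 3)" by (intro powr_mono2) auto
        moreover have "(real p ^ 3) powr (1 / 3) = real p"
        proof -
          have "real p ^ 3 = real p powr 3" using p by (simp add: powr_numeral)
          then show ?thesis by (simp only: powr_powr) simp
        qed
        ultimately have "real p \<le> Y powr (1 / 3)" by simp
        then have 1: "p \<le> nat \<lfloor>Y powr (1 / 3)\<rfloor>" by (simp add: le_nat_floor)
        have "2 ^ N \<le> real p ^ N" using p by (intro power_mono) auto
        then have "2 ^ N \<le> Y" using pN by linarith
        then have "real N \<le> log 2 Y" using Y by (simp add: le_log_iff powr_realpow)
        then have "N \<le> nat \<lfloor>log 2 Y\<rfloor>" by (simp add: le_nat_floor)
        then have "(p, N) \<in> T" using 1 p by (simp add: T_def)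
        moreover have "f (p, N) = l" using p(4) by (simp add: f_def)
        ultimately show False using l(3) by blast
      qed
    qed
    then have "tau_prime_count X \<le> card (insert 2 (f ` T))"
      unfolding tau_prime_count_def by (intro card_mono) (auto simp: T_def)
    also have "\<dots> \<le> Suc (card (f ` T))" by (rule card_insert_le_m1[THEN order_trans]) auto
    also have "\<dots> \<le> Suc (card T)"
    proof -
      have "finite T" by (simp add: T_def)
      then show ?thesis using card_image_le[of T f] by simp
    qed
    also have "card T = nat \<lfloor>Y powr (1 / 3)\<rfloor> * Suc (nat \<lfloor>log 2 Y\<rfloor>)" by (simp add: T_def)
    finally have "real (tau_prime_count X) \<le> real (Suc (nat \<lfloor>Y powr (1 / 3)\<rfloor> * Suc (nat \<lfloor>log 2 Y\<rfloor>)))"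
      by (simp only: of_nat_le_iff)
    also have "\<dots> = 1 + real (nat \<lfloor>Y powr (1 / 3)\<rfloor>) * (real (nat \<lfloor>log 2 Y\<rfloor>) + 1)"
      by (simp only: of_nat_Suc of_nat_mult add.commute)
    also have "\<dots> \<le> 1 + Y powr (1 / 3) * (log 2 Y + 1)"
      using Y by (intro add_left_mono mult_mono add_right_mono of_nat_floor) auto
    finally show ?thesis by (simp add: Y_def)
  qed
  have "(\<lambda>X. real (tau_prime_count X)) \<in> O[at_top](\<lambda>X. 1 + (C * X powr (20 / 19)) powr (1 / 3) * (log 2 (C * X powr (20 / 19)) + 1))"
  proof (rule landau_o.big_mono)
    show "eventually (\<lambda>X. norm (real (tau_prime_count X)) \<le> norm (1 + (C * X powr (20 / 19)) powr (1 / 3) * (log 2 (C * X powr (20 / 19)) + 1))) at_top"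
      using eventually_ge_at_top[of 2]
      by eventually_elim (use count in \<open>auto intro: order_trans[OF _ abs_ge_self]\<close>)
  qed
  also have "(\<lambda>X. 1 + (C * X powr (20 / 19)) powr (1 / 3) * (log 2 (C * X powr (20 / 19)) + 1)) \<in> O[at_top](\<lambda>X. X powr (13 / 22))"
    using C by real_asymp
  finally show ?thesis .
qed

end
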